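(* Let $E$ be a metric space. The following statements hold. (i) $(B_b(E),\sigma(B_b(E),\mathbf{ca}(E)))$ and $(B_b(E),\tau_{\mathcal{K}})$ are sequentially complete. (ii) $C_b(E)$ is $\tau_{\mathcal{K}}$-closed in $B_b(E)$ (hence, by (i), $(C_b(E),\tau_{\mathcal{K}})$ is sequentially complete). (iii) If $E$ is homeomorphic to a Borel subset of a Polish space, then $UC_b(E)$ is dense in $(C_b(E),\tau_{\mathcal{K}})$. (iv) $(UC_b(E),\tau_{\mathcal{K}})$ is sequentially complete if and only if $UC_b(E)=C_b(E)$. (v) For $\mathcal{S}(E)$ any one of the spaces $B_b(E)$, $C_b(E)$, $UC_b(E)$, $(\mathcal{S}(E),\tau_{\mathcal{K}})$ is metrizable if and only if $E$ is compact.
   Context: $B_b(E)$, $C_b(E)$, $UC_b(E)$ are the spaces of real-valued functions on $E$ that are, respectively, bounded Borel, bounded continuous, bounded uniformly continuous. $\mathbf{ca}(E)$ is the space of countably additive finite signed measures on the Borel $\sigma$-algebra of $E$. $\sigma(\mathcal{S}(E),\mathbf{ca}(E))$ is the weakest locally convex topology on $\mathcal{S}(E)$ making continuous all functionals $f\mapsto\int_Ef\,d\mu$, $\mu\in\mathbf{ca}(E)$. On each of these spaces, $\tau_{\mathcal{K}}$ is the locally convex topology generated by the seminorms $$p_{K,\mu}(f)=\sup_{x\in K}|f(x)|+\left|\int_Ef\,d\mu\right|,$$ where $K$ ranges over the non-empty compact subsets of $E$ and $\mu$ over $\mathbf{ca}(E)$. *)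

theory Defs
  imports "HOL-Analysis.Analysis"
begin

section \<open>Function spaces\<close>

definition Bb :: "('a::topological_space \<Rightarrow> real) set" where
  "Bb = {f. f \<in> borel_measurable borel \<and> bounded (range f)}"

definition Cb :: "('a::topological_space \<Rightarrow> real) set" where
  "Cb = {f. continuous_on UNIV f \<and> bounded (range f)}"

definition UCb :: "('a::metric_space \<Rightarrow> real) set" where
  "UCb = {f. uniformly_continuous_on UNIV f \<and> bounded (range f)}"


section \<open>Finite signed Borel measures\<close>

text \<open>A signed measure is a set function; as for \<^typ>\<open>'a measure\<close>, it is
  normalized to 0 on sets that are not Borel.\<close>

definition ca :: "('a::topological_space set \<Rightarrow> real) set" where
  "ca = {\<mu>. \<mu> {} = 0 \<and>
            (\<forall>A. range A \<subseteq> sets borel \<longrightarrow> disjoint_family A \<longrightarrow>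
                 (\<lambda>n::nat. \<mu> (A n)) sums \<mu> (\<Union>n. A n)) \<and>
            (\<forall>A. A \<notin> sets borel \<longrightarrow> \<mu> A = 0)}"

text \<open>The positive part of the Jordan decomposition,
  \<open>\<mu>\<^sup>+(A) = sup {\<mu>(B). B \<subseteq> A Borel}\<close>, as a measure on the Borel sets. The coercion
  \<^const>\<open>ennreal\<close> cuts off at 0, which is harmless because \<open>B = {}\<close> is admitted.\<close>

definition pos_part :: "('a::topological_space set \<Rightarrow> real) \<Rightarrow> 'a measure" where
  "pos_part \<mu> = measure_of UNIV (sets borel)
     (\<lambda>A. SUP B\<in>{B \<in> sets borel. B \<subseteq> A}. ennreal (\<mu> B))"

definition neg_part :: "('a::topological_space set \<Rightarrow> real) \<Rightarrow> 'a measure" where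
  "neg_part \<mu> = pos_part (\<lambda>A. - \<mu> A)"

definition signed_integral ::
    "('a::topological_space set \<Rightarrow> real) \<Rightarrow> ('a \<Rightarrow> real) \<Rightarrow> real" where
  "signed_integral \<mu> f = (LINT x|pos_part \<mu>. f x) - (LINT x|neg_part \<mu>. f x)"


section \<open>Topologies on spaces of functions\<close>

text \<open>The locally convex topology on a space \<open>S\<close> of functions generated by a family \<open>P\<close> of
  seminorms: finite intersections of \<open>p\<close>-balls around \<open>f\<close> form a neighbourhood basis at \<open>f\<close>.\<close>

definition seminorm_topology ::
    "('a \<Rightarrow> real) set \<Rightarrow> (('a \<Rightarrow> real) \<Rightarrow> real) set \<Rightarrow> ('a \<Rightarrow> real) topology" where
  "seminorm_topology S P = topology (\<lambda>U. U \<subseteq> S \<and>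
     (\<forall>f\<in>U. \<exists>F r. finite F \<and> F \<subseteq> P \<and> r > 0 \<and>
        {g \<in> S. \<forall>p\<in>F. p (\<lambda>x. g x - f x) < r} \<subseteq> U))"

lemma openin_seminorm_topology:
  "openin (seminorm_topology S P) U \<longleftrightarrow> U \<subseteq> S \<and>
     (\<forall>f\<in>U. \<exists>F r. finite F \<and> F \<subseteq> P \<and> r > 0 \<and>
        {g \<in> S. \<forall>p\<in>F. p (\<lambda>x. g x - f x) < r} \<subseteq> U)"
proof -
  define N where "N f F r = {g \<in> S. \<forall>p\<in>F. p (\<lambda>x. g x - f x) < r}" for f F and r :: real
  define L where "L U \<longleftrightarrow> U \<subseteq> S \<and>
    (\<forall>f\<in>U. \<exists>F r. finite F \<and> F \<subseteq> P \<and> r > 0 \<and> N f F r \<subseteq> U)" for U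
  have "L (U \<inter> V)" if "L U" "L V" for U V
    unfolding L_def
  proof (intro conjI ballI)
    show "U \<inter> V \<subseteq> S" using that by (auto simp: L_def)
    fix f assume "f \<in> U \<inter> V"
    then obtain F r G s where "finite F" "F \<subseteq> P" "r > 0" "N f F r \<subseteq> U"
      and "finite G" "G \<subseteq> P" "s > 0" "N f G s \<subseteq> V"
      using \<open>L U\<close> \<open>L V\<close> unfolding L_def by (metis IntD1 IntD2)
    moreover have "N f (F \<union> G) (min r s) \<subseteq> N f F r \<inter> N f G s"
      by (auto simp: N_def)
    ultimately show "\<exists>H t. finite H \<and> H \<subseteq> P \<and> t > 0 \<and> N f H t \<subseteq> U \<inter> V"
      by (intro exI[of _ "F \<union> G"] exI[of _ "min r s"]) auto
  qed
  moreover have "L (\<Union>\<U>)" if "\<forall>U\<in>\<U>. L U" for \<U>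
    unfolding L_def
  proof (intro conjI ballI)
    show "\<Union>\<U> \<subseteq> S" using that by (auto simp: L_def)
    fix f assume "f \<in> \<Union>\<U>"
    then obtain U where "U \<in> \<U>" "f \<in> U" by blast
    with that obtain F r where "finite F" "F \<subseteq> P" "r > 0" "N f F r \<subseteq> U"
      unfolding L_def by metis
    with \<open>U \<in> \<U>\<close> show "\<exists>F r. finite F \<and> F \<subseteq> P \<and> r > 0 \<and> N f F r \<subseteq> \<Union>\<U>"
      by blast
  qed
  ultimately have "istopology L" by (auto simp: istopology_def)
  then have "openin (topology L) = L" by (rule topology_inverse')
  then show ?thesis
    unfolding seminorm_topology_def L_def[abs_def] N_def by simp
qed

lemma topspace_seminorm_topology [simp]: "topspace (seminorm_topology S P) = S"
proof
  show "topspace (seminorm_topology S P) \<subseteq> S"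
    using openin_seminorm_topology[of S P "topspace (seminorm_topology S P)"] by simp
  have "openin (seminorm_topology S P) S"
    unfolding openin_seminorm_topology
    by (intro conjI ballI exI[of _ "{}"] exI[of _ 1]) auto
  then show "S \<subseteq> topspace (seminorm_topology S P)" by (rule openin_subset)
qed

definition seminorm_K ::
    "'a::topological_space set \<Rightarrow> ('a set \<Rightarrow> real) \<Rightarrow> ('a \<Rightarrow> real) \<Rightarrow> real" where
  "seminorm_K K \<mu> f = (SUP x\<in>K. \<bar>f x\<bar>) + \<bar>signed_integral \<mu> f\<bar>"

definition tau_K :: "('a::topological_space \<Rightarrow> real) set \<Rightarrow> ('a \<Rightarrow> real) topology" where
  "tau_K S = seminorm_topology S {seminorm_K K \<mu> | K \<mu>. compact K \<and> K \<noteq> {} \<and> \<mu> \<in> ca}"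

text \<open>The topology \<open>\<sigma>(S, ca)\<close>. It is the weakest of all topologies on \<open>S\<close> making the
  functionals \<open>f \<mapsto> \<integral> f d\<mu>\<close> continuous (see the two lemmas below); the functionals being linear,
  it is locally convex, so it is also the weakest locally convex one.\<close>

definition sigma_ca :: "('a::topological_space \<Rightarrow> real) set \<Rightarrow> ('a \<Rightarrow> real) topology" where
  "sigma_ca S = topology_generated_by
     {{f \<in> S. signed_integral \<mu> f \<in> V} | \<mu> V. \<mu> \<in> ca \<and> open V}"

lemma topspace_sigma_ca [simp]: "topspace (sigma_ca S) = S"
proof -
  have "(\<lambda>_. 0) \<in> ca" by (simp add: ca_def)
  then have "S \<in> {{f \<in> S. signed_integral \<mu> f \<in> V} | \<mu> V. \<mu> \<in> ca \<and> open V}"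
    by (intro CollectI exI[of _ "\<lambda>_. 0"] exI[of _ UNIV]) auto
  then show ?thesis
    unfolding sigma_ca_def topology_generated_by_topspace by blast
qed

lemma continuous_map_sigma_ca:
  assumes "\<mu> \<in> ca"
  shows "continuous_map (sigma_ca S) euclideanreal (signed_integral \<mu>)"
  unfolding continuous_map_def
proof (intro conjI allI impI)
  fix V :: "real set" assume "openin euclideanreal V"
  with assms show "openin (sigma_ca S) {f \<in> topspace (sigma_ca S). signed_integral \<mu> f \<in> V}"
    unfolding topspace_sigma_ca unfolding sigma_ca_def
    by (intro topology_generated_by_Basis) auto
qed auto

lemma sigma_ca_weakest:
  assumes T: "topspace T = S"
    and cont: "\<And>\<mu>. \<mu> \<in> ca \<Longrightarrow> continuous_map T euclideanreal (signed_integral \<mu>)"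
    and "openin (sigma_ca S) U"
  shows "openin T U"
  using assms(3) unfolding sigma_ca_def openin_topology_generated_by_iff
proof induction
  case (Basis A)
  then show ?case using T cont by (auto simp: continuous_map_def)
qed auto


section \<open>Sequential completeness\<close>

text \<open>\<open>T\<close> is meant to be a vector space topology on a space of functions; Cauchy sequences
  are those of its translation-invariant uniformity.\<close>

definition tvs_Cauchy :: "('a \<Rightarrow> real) topology \<Rightarrow> (nat \<Rightarrow> 'a \<Rightarrow> real) \<Rightarrow> bool" where
  "tvs_Cauchy T f \<longleftrightarrow> range f \<subseteq> topspace T \<and>
     (\<forall>U. openin T U \<and> (\<lambda>_. 0) \<in> U \<longrightarrow>
        (\<exists>N. \<forall>m\<ge>N. \<forall>n\<ge>N. (\<lambda>x. f m x - f n x) \<in> U))"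

definition sequentially_complete :: "('a \<Rightarrow> real) topology \<Rightarrow> bool" where
  "sequentially_complete T \<longleftrightarrow>
     (\<forall>f. tvs_Cauchy T f \<longrightarrow> (\<exists>l. limitin T f l sequentially))"

end

theory Submission
  imports Defs
begin

text \<open>Every part rests on two facts about sequences of bounded Borel functions. The first is
  uniform boundedness (\<open>weakly_bounded_imp_bounded\<close>): if the integrals of \<open>f\<^sub>n\<close>
  against each \<open>\<mu>\<close> form a bounded sequence, then the sup-norms of the \<open>f\<^sub>n\<close> are bounded. A
  gliding hump shows this, using purely atomic measures only. The second is dominated convergence
  (\<open>tendsto_signed_integral\<close>), which applies because the Jordan parts of a finite signed
  measure are finite.

  Completeness follows. Testing a weak Cauchy sequence with Dirac measures gives a pointwise limit;
  by uniform boundedness this limit is bounded, and dominated convergence identifies the limits of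
  all integrals (\<open>weakly_Cauchy_limit\<close>). Under \<open>\<tau>\<^sub>K\<close> the convergence is moreover uniform on
  compact sets. Such convergence preserves sequential continuity, because a convergent sequence and
  its limit form a compact set; so the continuous functions are \<open>\<tau>\<^sub>K\<close>-closed.

  Density and the criterion for uniformly continuous functions use one construction
  (\<open>Lipschitz_approximation\<close>): the Lipschitz regularizations
  \<open>x \<mapsto> inf\<^sub>y (f y + n * dist x y)\<close> of a bounded continuous \<open>f\<close> have the same bound as \<open>f\<close>,
  converge to \<open>f\<close> uniformly on compact sets and hence, by dominated convergence, in \<open>\<tau>\<^sub>K\<close>. So \<open>f\<close>
  is a \<open>\<tau>\<^sub>K\<close>-limit of a sequence of bounded uniformly continuous functions, and if these form a
  sequentially complete space, \<open>f\<close> is one of them.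

  If the underlying space is compact, every seminorm is dominated by a multiple of the sup-norm,
  which is itself one of the seminorms; so the sup-distance metrizes \<open>\<tau>\<^sub>K\<close>. If it is not compact,
  there are humps \<open>h\<^sub>k\<close> of height 1 that eventually vanish on every given compact set. Then
  \<open>n h\<^sub>k \<rightarrow> 0\<close> as \<open>k \<rightarrow> \<infinity>\<close>, for every \<open>n\<close>, and a metric would produce a diagonal sequence
  \<open>n h\<^bsub>k(n)\<^esub> \<rightarrow> 0\<close>, which is unbounded in sup-norm; this contradicts uniform boundedness.\<close>

section \<open>Spaces of bounded functions\<close>

lemma Bb_bound: "f \<in> Bb \<Longrightarrow> \<exists>C. \<forall>x. \<bar>f x\<bar> \<le> C"
  by (simp add: Bb_def bounded_iff)

lemma Bb_diff: "f \<in> Bb \<Longrightarrow> g \<in> Bb \<Longrightarrow> (\<lambda>x. f x - g x) \<in> Bb"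
  using bounded_minus_comp[of f UNIV g] by (auto simp: Bb_def)

lemma bdd_above_abs_Bb: "f \<in> Bb \<Longrightarrow> bdd_above ((\<lambda>x. \<bar>f x\<bar>) ` K)"
  using Bb_bound[of f] by (fastforce simp: bdd_above_def)

lemma UCb_subset_Cb: "UCb \<subseteq> Cb"
  by (auto simp: UCb_def Cb_def uniformly_continuous_imp_continuous)

lemma Cb_subset_Bb: "Cb \<subseteq> Bb"
  by (auto simp: Cb_def Bb_def borel_measurable_continuous_onI)

lemma UCb_diff: "f \<in> UCb \<Longrightarrow> g \<in> UCb \<Longrightarrow> (\<lambda>x. f x - g x) \<in> UCb"
  using bounded_minus_comp[of f UNIV g] by (auto simp: UCb_def intro: uniformly_continuous_on_diff)

lemma zero_in_UCb: "(\<lambda>_. 0) \<in> UCb"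
  by (simp add: UCb_def uniformly_continuous_on_const)

lemma Lipschitz_in_UCb:
  fixes f :: "'a::metric_space \<Rightarrow> real"
  assumes "c \<ge> 0" "\<And>x y. \<bar>f x - f y\<bar> \<le> c * dist x y" "\<And>x. \<bar>f x\<bar> \<le> C"
  shows "f \<in> UCb"
proof -
  have "c-lipschitz_on UNIV f" using assms(1,2) by (intro lipschitz_onI) (auto simp: dist_real_def)
  then have "uniformly_continuous_on UNIV f" by (rule lipschitz_on_uniformly_continuous)
  then show ?thesis using assms(3) by (auto simp: UCb_def bounded_iff)
qed

section \<open>Finite signed measures\<close>

lemma zero_in_ca: "(\<lambda>_. 0) \<in> ca"
  by (simp add: ca_def)

lemma ca_uminus: "\<mu> \<in> ca \<Longrightarrow> (\<lambda>A. - \<mu> A) \<in> ca"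
  by (auto simp: ca_def intro: sums_minus)

lemma ca_sums:
  assumes "\<mu> \<in> ca" "\<And>n. A n \<in> sets borel" "disjoint_family A"
  shows "(\<lambda>n::nat. \<mu> (A n)) sums \<mu> (\<Union>n. A n)"
  using assms by (auto simp: ca_def image_subset_iff)

lemma ca_Un:
  assumes "\<mu> \<in> ca" "A \<in> sets borel" "B \<in> sets borel" "A \<inter> B = {}"
  shows "\<mu> (A \<union> B) = \<mu> A + \<mu> B"
proof -
  have "(\<lambda>n. \<mu> (binaryset A B n)) sums \<mu> (\<Union>n. binaryset A B n)"
    using assms by (intro ca_sums) (auto simp: binaryset_def disjoint_family_on_def)
  moreover have "(\<lambda>n. \<mu> (binaryset A B n)) sums (\<mu> A + \<mu> B)"
    using assms(1) by (intro binaryset_sums) (simp add: ca_def)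
  ultimately show ?thesis
    by (simp add: UN_binaryset_eq sums_unique2)
qed

text \<open>If \<open>\<mu>\<close> is unbounded on the subsets of \<open>A\<close>, choose \<open>B \<subseteq> A\<close> with \<open>\<bar>\<mu> B\<bar> > \<bar>\<mu> A\<bar> + 1\<close>, so that also
  \<open>\<bar>\<mu> (A - B)\<bar> \<ge> 1\<close>. On one of the two pieces \<open>\<mu>\<close> is again unbounded; keep it and split off the
  other. Iterating splits off disjoint sets of measure at least 1 in absolute value, whose measures
  cannot form a convergent series.\<close>

lemma ca_bounded:
  assumes mu: "\<mu> \<in> ca"
  shows "\<exists>C. \<forall>B\<in>sets borel. \<bar>\<mu> B\<bar> \<le> C"
proof (rule ccontr)
  define unb where "unb A \<longleftrightarrow> A \<in> sets borel \<and>
    \<not> (\<exists>C. \<forall>B\<in>sets borel. B \<subseteq> A \<longrightarrow> \<bar>\<mu> B\<bar> \<le> C)" for A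
  assume "\<not> ?thesis"
  then have start: "unb UNIV" by (simp add: unb_def)
  have step: "\<exists>A'. unb A' \<and> A' \<subseteq> A \<and> \<bar>\<mu> (A - A')\<bar> \<ge> 1" if A: "unb A" for A
  proof -
    obtain B where B: "B \<in> sets borel" "B \<subseteq> A" "\<bar>\<mu> B\<bar> > \<bar>\<mu> A\<bar> + 1"
      using A unfolding unb_def by (meson not_le)
    have sets: "A \<in> sets borel" "A - B \<in> sets borel" using A B by (auto simp: unb_def)
    have "\<mu> (B \<union> (A - B)) = \<mu> B + \<mu> (A - B)"
      using sets B by (intro ca_Un[OF mu]) auto
    then have diff: "\<mu> A = \<mu> B + \<mu> (A - B)" using B(2) by (simp add: Un_absorb1)
    have "unb B \<or> unb (A - B)"
    proof (rule ccontr)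
      assume "\<not> ?thesis"
      then have "\<exists>C. \<forall>D\<in>sets borel. D \<subseteq> B \<longrightarrow> \<bar>\<mu> D\<bar> \<le> C"
        "\<exists>C. \<forall>D\<in>sets borel. D \<subseteq> A - B \<longrightarrow> \<bar>\<mu> D\<bar> \<le> C"
        using sets B(1) by (simp_all add: unb_def)
      then obtain C1 C2 where C: "\<forall>D\<in>sets borel. D \<subseteq> B \<longrightarrow> \<bar>\<mu> D\<bar> \<le> C1"
        "\<forall>D\<in>sets borel. D \<subseteq> A - B \<longrightarrow> \<bar>\<mu> D\<bar> \<le> C2"
        by (elim exE)
      have "\<bar>\<mu> D\<bar> \<le> C1 + C2" if D: "D \<in> sets borel" "D \<subseteq> A" for D
      proof -
        have "\<mu> ((D \<inter> B) \<union> (D - B)) = \<mu> (D \<inter> B) + \<mu> (D - B)"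
          using D B by (intro ca_Un[OF mu]) auto
        moreover have "\<bar>\<mu> (D \<inter> B)\<bar> \<le> C1" using D B by (intro C(1)[rule_format]) auto
        moreover have "\<bar>\<mu> (D - B)\<bar> \<le> C2" using D B by (intro C(2)[rule_format]) auto
        ultimately show ?thesis by (simp add: Int_Diff_Un)
      qed
      then have "\<exists>C. \<forall>D\<in>sets borel. D \<subseteq> A \<longrightarrow> \<bar>\<mu> D\<bar> \<le> C" by auto
      with A show False by (simp add: unb_def)
    qed
    then show ?thesis
    proof
      assume "unb B"
      moreover have "\<bar>\<mu> (A - B)\<bar> \<ge> 1" using B(3) diff by linarith
      ultimately show ?thesis using B(2) by blast
    next
      assume "unb (A - B)"
      moreover have "A - (A - B) = B" using B(2) by blast
      ultimately show ?thesis using B(3) by (intro exI[of _ "A - B"]) auto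
    qed
  qed
  obtain A where A: "\<And>n. unb (A n)" "\<And>n. A (Suc n) \<subseteq> A n" "\<And>n. \<bar>\<mu> (A n - A (Suc n))\<bar> \<ge> 1"
    using dependent_nat_choice[of "\<lambda>_. unb" "\<lambda>_ A A'. A' \<subseteq> A \<and> \<bar>\<mu> (A - A')\<bar> \<ge> 1"] start step
    by metis
  have anti: "A n \<subseteq> A m" if "m \<le> n" for m n
    using lift_Suc_antimono_le[of A, OF A(2) that] .
  have "disjoint_family (\<lambda>n. A n - A (Suc n))"
    unfolding disjoint_family_on_def
  proof (intro ballI impI)
    fix m n :: nat assume "m \<noteq> n"
    then have "Suc m \<le> n \<or> Suc n \<le> m" by linarith
    then show "(A m - A (Suc m)) \<inter> (A n - A (Suc n)) = {}"
      using anti by blast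
  qed
  then have "summable (\<lambda>n. \<mu> (A n - A (Suc n)))"
    using A(1) by (intro sums_summable[OF ca_sums[OF mu]]) (auto simp: unb_def)
  then have "(\<lambda>n. \<mu> (A n - A (Suc n))) \<longlonglongrightarrow> 0" by (rule summable_LIMSEQ_zero)
  then have "\<forall>\<^sub>F n in sequentially. \<bar>\<mu> (A n - A (Suc n))\<bar> < 1"
    by (simp add: tendsto_iff)
  then obtain n where "\<bar>\<mu> (A n - A (Suc n))\<bar> < 1" by (auto simp: eventually_sequentially)
  with A(3)[of n] show False by simp
qed

lemma space_pos_part [simp]: "space (pos_part \<mu>) = UNIV"
  by (simp add: pos_part_def space_measure_of_conv)

lemma sets_pos_part [simp, measurable_cong]: "sets (pos_part \<mu>) = sets borel"
  using sets.sigma_sets_eq[of borel] by (simp add: pos_part_def sets_measure_of_conv)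

text \<open>The bound on \<open>\<mu>\<close> suffices: the total mass is either the supremum in the definition or the
  value 0 that \<^const>\<open>measure_of\<close> assigns to a set function that is not a measure.\<close>

lemma finite_measure_pos_part:
  assumes "\<mu> \<in> ca"
  shows "finite_measure (pos_part \<mu>)"
proof
  obtain C where "\<forall>B\<in>sets borel. \<bar>\<mu> B\<bar> \<le> C" using ca_bounded[OF assms] by blast
  then have "(SUP B\<in>{B \<in> sets borel. B \<subseteq> UNIV}. ennreal (\<mu> B)) \<le> ennreal C"
    by (intro SUP_least ennreal_leI) fastforce
  then have "emeasure (pos_part \<mu>) UNIV \<le> ennreal C"
    unfolding pos_part_def by (simp add: emeasure_measure_of_conv)
  then show "emeasure (pos_part \<mu>) (space (pos_part \<mu>)) \<noteq> \<infinity>"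
    by (auto simp: top_unique)
qed

lemma finite_measure_neg_part: "\<mu> \<in> ca \<Longrightarrow> finite_measure (neg_part \<mu>)"
  unfolding neg_part_def by (intro finite_measure_pos_part ca_uminus)

lemma sets_neg_part [simp, measurable_cong]: "sets (neg_part \<mu>) = sets borel"
  by (simp add: neg_part_def)

lemma integrable_Bb:
  assumes "finite_measure M" "sets M = sets borel" "f \<in> Bb"
  shows "integrable M f"
proof -
  interpret finite_measure M by fact
  obtain C where "\<forall>x. \<bar>f x\<bar> \<le> C" using Bb_bound[OF assms(3)] by (elim exE)
  moreover have "f \<in> borel_measurable M"
    using assms(2,3) by (auto simp: Bb_def cong: measurable_cong_sets)
  ultimately show ?thesis by (intro integrable_const_bound[of _ C]) auto
qed

lemma signed_integral_diff:
  assumes "\<mu> \<in> ca" "f \<in> Bb" "g \<in> Bb"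
  shows "signed_integral \<mu> (\<lambda>x. f x - g x) = signed_integral \<mu> f - signed_integral \<mu> g"
proof -
  have "integrable (pos_part \<mu>) f" "integrable (pos_part \<mu>) g"
    "integrable (neg_part \<mu>) f" "integrable (neg_part \<mu>) g"
    using assms by (auto intro!: integrable_Bb finite_measure_pos_part finite_measure_neg_part)
  then show ?thesis by (simp add: signed_integral_def)
qed

lemma signed_integral_zero [simp]: "signed_integral \<mu> (\<lambda>_. 0) = 0"
  by (simp add: signed_integral_def)

lemma tendsto_integral_bounded:
  fixes f :: "nat \<Rightarrow> 'a::topological_space \<Rightarrow> real"
  assumes "finite_measure M" and M: "sets M = sets borel"
    and f: "\<And>n. f n \<in> borel_measurable borel" and bd: "\<And>n x. \<bar>f n x\<bar> \<le> C"
    and lim: "\<And>x. (\<lambda>n. f n x) \<longlonglongrightarrow> l x"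
  shows "(\<lambda>n. LINT x|M. f n x) \<longlonglongrightarrow> (LINT x|M. l x)"
proof -
  interpret finite_measure M by fact
  have fM: "f n \<in> borel_measurable M" for n
    using f M by (auto cong: measurable_cong_sets)
  then have lM: "l \<in> borel_measurable M"
    by (rule borel_measurable_LIMSEQ_real[OF lim])
  show ?thesis
    by (rule integral_dominated_convergence[where w = "\<lambda>_. C"])
       (use fM lM bd lim in auto)
qed

lemma tendsto_signed_integral:
  assumes "\<mu> \<in> ca" "\<And>n. f n \<in> borel_measurable borel" "\<And>n x. \<bar>f n x\<bar> \<le> C"
    "\<And>x. (\<lambda>n. f n x) \<longlonglongrightarrow> l x"
  shows "(\<lambda>n. signed_integral \<mu> (f n)) \<longlonglongrightarrow> signed_integral \<mu> l"
  unfolding signed_integral_def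
  using assms
  by (intro tendsto_diff tendsto_integral_bounded finite_measure_pos_part finite_measure_neg_part)
     auto

text \<open>The constant is the total variation of \<open>\<mu>\<close>, obtained from the masses of the two parts.\<close>

lemma signed_integral_le:
  assumes "\<mu> \<in> ca"
  shows "\<exists>c\<ge>0. \<forall>f\<in>Bb. \<forall>C. (\<forall>x. \<bar>f x\<bar> \<le> C) \<longrightarrow> \<bar>signed_integral \<mu> f\<bar> \<le> c * C"
proof -
  have bound: "\<bar>LINT x|M. f x\<bar> \<le> measure M UNIV * C"
    if "finite_measure M" "sets M = sets borel" "f \<in> Bb" "\<And>x. \<bar>f x\<bar> \<le> C"
    for f C and M :: "'a measure"
  proof -
    interpret finite_measure M by fact
    have "space M = UNIV" using that(2) sets_eq_imp_space_eq by fastforce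
    have "\<bar>LINT x|M. f x\<bar> \<le> (LINT x|M. \<bar>f x\<bar>)" by (rule integral_abs_bound)
    also have "\<dots> \<le> (LINT x|M. C)"
      using integrable_Bb[OF that(1-3)] that(4) by (intro integral_mono) auto
    finally show ?thesis using \<open>space M = UNIV\<close> by simp
  qed
  let ?c = "measure (pos_part \<mu>) UNIV + measure (neg_part \<mu>) UNIV"
  have "\<bar>signed_integral \<mu> f\<bar> \<le> ?c * C" if "f \<in> Bb" "\<forall>x. \<bar>f x\<bar> \<le> C" for f C
  proof -
    have "\<bar>LINT x|pos_part \<mu>. f x\<bar> \<le> measure (pos_part \<mu>) UNIV * C"
      using that by (intro bound finite_measure_pos_part[OF assms]) auto
    moreover have "\<bar>LINT x|neg_part \<mu>. f x\<bar> \<le> measure (neg_part \<mu>) UNIV * C"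
      using that by (intro bound finite_measure_neg_part[OF assms]) auto
    ultimately show ?thesis unfolding signed_integral_def distrib_right by linarith
  qed
  then show ?thesis by (intro exI[of _ ?c]) (auto intro: add_nonneg_nonneg)
qed

lemma measure_in_ca:
  assumes "finite_measure M" "sets M = sets borel"
  shows "measure M \<in> ca"
proof -
  interpret finite_measure M by fact
  show ?thesis
    using assms(2) by (auto simp: ca_def measure_notin_sets intro!: finite_measure_UNION)
qed

text \<open>For a positive measure the supremum defining the positive part is attained at the whole set,
  and the one defining the negative part at the empty set.\<close>

lemma signed_integral_measure:
  assumes "finite_measure M" and M: "sets M = sets borel"
  shows "signed_integral (measure M) f = (LINT x|M. f x)"
proof -
  interpret finite_measure M by fact
  have space: "space M = UNIV" using M sets_eq_imp_space_eq by fastforce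
  have sig: "sigma_sets UNIV (sets borel) = sets (borel :: 'a measure)"
    using sets.sigma_sets_eq[of borel] by simp
  have "(SUP B\<in>{B \<in> sets borel. B \<subseteq> A}. ennreal (measure M B)) = emeasure M A"
    if "A \<in> sets borel" for A
    using that M
    by (intro antisym SUP_least SUP_upper2[of A])
       (auto simp: emeasure_eq_measure intro!: finite_measure_mono ennreal_leI)
  then have "pos_part (measure M) = measure_of UNIV (sets borel) (emeasure M)"
    unfolding pos_part_def by (intro measure_of_eq) (auto simp: sig)
  then have pos: "pos_part (measure M) = M"
    using measure_of_of_measure[of M] by (simp add: space M)
  have "(SUP B\<in>{B \<in> sets borel. B \<subseteq> A}. ennreal (- measure M B)) = 0" for A :: "'a set"
    by (intro antisym SUP_least) (auto simp: ennreal_neg)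
  then have "emeasure (neg_part (measure M)) A = 0" for A
    unfolding neg_part_def pos_part_def by (simp add: emeasure_measure_of_conv)
  then have "AE x in neg_part (measure M). f x = 0"
    by (intro AE_I[of _ _ UNIV]) (auto simp: neg_part_def)
  then have "(LINT x|neg_part (measure M). f x) = 0"
    by (rule integral_eq_zero_AE)
  with pos show ?thesis by (simp add: signed_integral_def)
qed

text \<open>The measure \<open>\<Sum>k. a k \<cdot> \<delta>\<^bsub>x k\<^esub>\<close> is the image under \<open>x\<close> of the weighted counting measure on the
  natural numbers.\<close>

lemma atomic_measure_in_ca:
  fixes a :: "nat \<Rightarrow> real" and x :: "nat \<Rightarrow> 'a::topological_space"
  assumes a: "summable a" "\<And>k. 0 \<le> a k"
  obtains \<mu> where "\<mu> \<in> ca" "\<And>f. f \<in> Bb \<Longrightarrow> signed_integral \<mu> f = (\<Sum>k. a k * f (x k))"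
proof
  let ?N = "density (count_space UNIV) (\<lambda>k. ennreal (a k))"
  let ?M = "distr ?N borel x"
  have x: "x \<in> measurable ?N borel" by simp
  have "emeasure ?N UNIV = (\<Sum>k. ennreal (a k))"
    by (simp add: emeasure_density nn_integral_count_space_nat)
  also have "\<dots> = ennreal (\<Sum>k. a k)" using a by (intro suminf_ennreal2) auto
  finally have "finite_measure ?N" by (intro finite_measureI) simp
  then have fin: "finite_measure ?M" using x by (rule finite_measure.finite_measure_distr)
  then show "measure ?M \<in> ca" by (rule measure_in_ca) simp
  fix f :: "'a \<Rightarrow> real" assume f: "f \<in> Bb"
  obtain C where C: "\<forall>y. \<bar>f y\<bar> \<le> C" using Bb_bound[OF f] by (elim exE)
  have "summable (\<lambda>k. \<bar>a k * f (x k)\<bar>)"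
  proof (rule summable_comparison_test')
    show "summable (\<lambda>k. a k * C)" using a by (intro summable_mult2)
    show "norm \<bar>a k * f (x k)\<bar> \<le> a k * C" if "k \<ge> 0" for k
      using a C by (auto simp: abs_mult intro: mult_left_mono)
  qed
  then have int: "integrable (count_space UNIV) (\<lambda>k. a k * f (x k))"
    by (simp add: integrable_count_space_nat_iff)
  have "signed_integral (measure ?M) f = (LINT y|?M. f y)"
    using fin by (rule signed_integral_measure) simp
  also have "\<dots> = (LINT k|?N. f (x k))"
    using f by (intro integral_distr) (auto simp: Bb_def)
  also have "\<dots> = (LINT k|count_space UNIV. a k * f (x k))"
    using a by (subst integral_density) auto
  also have "\<dots> = (\<Sum>k. a k * f (x k))"
    using int by (rule integral_count_space_nat)
  finally show "signed_integral (measure ?M) f = (\<Sum>k. a k * f (x k))" .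
qed

lemma Dirac_in_ca:
  fixes x :: "'a::topological_space"
  obtains \<mu> where "\<mu> \<in> ca" "\<And>f. f \<in> Bb \<Longrightarrow> signed_integral \<mu> f = f x"
proof -
  let ?a = "\<lambda>k. if k = 0 then 1 else 0 :: real"
  have a: "summable ?a" by simp
  obtain \<mu> where mu: "\<mu> \<in> ca"
    "\<And>f. f \<in> Bb \<Longrightarrow> signed_integral \<mu> f = (\<Sum>k. ?a k * f x)"
    by (rule atomic_measure_in_ca[OF a, of "\<lambda>_. x"]) auto
  have "(\<Sum>k. ?a k * f x) = f x" for f :: "'a \<Rightarrow> real"
    by (subst suminf_finite[of "{0}"]) auto
  with mu show ?thesis by (intro that) auto
qed

section \<open>Uniform boundedness\<close>

text \<open>A gliding hump. If the \<open>f n\<close> are not uniformly bounded, there are indices \<open>n k\<close> and points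
  \<open>x k\<close> at which \<open>f (n k)\<close> is large and almost attains its sup-norm. Weights \<open>a k\<close>, each either 0 or
  \<open>5\<^sup>-\<^sup>k\<close>, are chosen successively so that the first \<open>k + 1\<close> atoms contribute to
  \<open>\<Sum>j. a j * f (n k) (x j)\<close> at least half of \<open>5\<^sup>-\<^sup>k * \<bar>f (n k) (x k)\<bar>\<close> in absolute value: one of the
  two choices achieves this, since the resulting sums differ by that quantity. The geometric decay
  keeps the contribution of the later atoms at most a third of it, so these sums are unbounded.\<close>

lemma uniform_boundedness_atomic:
  fixes f :: "nat \<Rightarrow> 'a \<Rightarrow> real"
  assumes bdd: "\<And>n. bounded (range (f n))"
    and sums: "\<And>a x. summable a \<Longrightarrow> (\<And>k. 0 \<le> a k) \<Longrightarrow>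
      bounded (range (\<lambda>n. \<Sum>k. a k * f n (x k)))"
  shows "\<exists>C. \<forall>n x. \<bar>f n x\<bar> \<le> C"
proof (rule ccontr)
  assume unb: "\<not> ?thesis"
  (* 3/4 makes the tail of the series at most 1/3, against the 1/2 kept by the choice of weights;
     the growth rate 6 * k * 5 ^ k turns the remaining sixth into k *)
  have "\<exists>n x. \<bar>f n x\<bar> \<ge> 6 * real k * 5 ^ k \<and> (\<forall>y. 3/4 * \<bar>f n y\<bar> \<le> \<bar>f n x\<bar>)" for k
  proof -
    let ?C = "6 * real k * 5 ^ k"
    obtain n y where y: "\<bar>f n y\<bar> > ?C" using unb by (meson not_le)
    have bd: "bdd_above (range (\<lambda>x. \<bar>f n x\<bar>))"
      using bdd[of n] by (auto simp: bounded_iff bdd_above_def)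
    let ?s = "SUP x. \<bar>f n x\<bar>"
    have s: "\<bar>f n z\<bar> \<le> ?s" for z using bd by (intro cSUP_upper) auto
    have "0 \<le> ?C" by simp
    with y s[of y] have "?C < ?s" "0 < ?s" by linarith+
    then have "max ?C (3/4 * ?s) < ?s" by simp
    then obtain x where "max ?C (3/4 * ?s) < \<bar>f n x\<bar>"
      using bd by (subst (asm) less_cSUP_iff) auto
    moreover from this have "3/4 * \<bar>f n z\<bar> \<le> \<bar>f n x\<bar>" for z using s[of z] by simp
    ultimately show ?thesis by (intro exI[of _ n] exI[of _ x]) simp
  qed
  then obtain n x where nx: "\<And>k. \<bar>f (n k) (x k)\<bar> \<ge> 6 * real k * 5 ^ k"
    "\<And>k y. 3/4 * \<bar>f (n k) y\<bar> \<le> \<bar>f (n k) (x k)\<bar>"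
    by metis
  define r where "r k = (1/5 :: real) ^ k" for k :: nat
  define u where "u k = \<bar>f (n k) (x k)\<bar>" for k
  have rpos: "r k > 0" for k by (simp add: r_def)
  define P where "P a k v \<longleftrightarrow> (v = 0 \<or> v = r k) \<and>
    r k * u k / 2 \<le> \<bar>(\<Sum>j<k. a j * f (n k) (x j)) + v * f (n k) (x k)\<bar>"
    for a :: "nat \<Rightarrow> real" and k v
  (* course-of-values recursion: the choice of a k depends on all earlier weights *)
  have "\<exists>a. \<forall>k. P a k (a k)"
  proof (rule dependent_wf_choice[OF wf_less_than])
    show "P a k v = P b k v" if "\<And>j. (j, k) \<in> less_than \<Longrightarrow> a j = b j" for a b k v
      using that by (simp add: P_def)
    fix k a
    let ?s = "\<Sum>j<k. a j * f (n k) (x j)"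
    have "r k * u k = \<bar>r k * f (n k) (x k)\<bar>" using rpos[of k] by (simp add: u_def abs_mult)
    then have "r k * u k / 2 \<le> \<bar>?s\<bar> \<or> r k * u k / 2 \<le> \<bar>?s + r k * f (n k) (x k)\<bar>"
      by linarith
    then show "\<exists>v. P a k v" by (auto simp: P_def)
  qed
  then obtain a where a: "\<And>k. P a k (a k)" by blast
  have a0: "0 \<le> a k" "a k \<le> r k" for k
    using a[of k] rpos[of k] by (auto simp: P_def)
  have sum_r: "summable r" unfolding r_def by (intro summable_geometric) simp
  have sum_a: "summable a"
    using sum_r by (rule summable_comparison_test'[of _ 0]) (use a0 in auto)
  have main: "real k \<le> \<bar>\<Sum>j. a j * f (n k) (x j)\<bar>" for k
  proof -
    let ?t = "\<lambda>j. a j * f (n k) (x j)"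
    have t: "norm (?t j) \<le> r j * (4/3 * u k)" for j
    proof -
      have "\<bar>f (n k) (x j)\<bar> \<le> 4/3 * u k" using nx(2)[of k "x j"] by (simp add: u_def)
      then have "\<bar>a j\<bar> * \<bar>f (n k) (x j)\<bar> \<le> r j * (4/3 * u k)"
        using a0[of j] rpos[of j] by (intro mult_mono) auto
      then show ?thesis by (simp add: abs_mult)
    qed
    have st: "summable ?t"
      using summable_mult2[OF sum_r] t by (rule summable_comparison_test'[where N = 0])
    have split: "(\<Sum>j. ?t j) = (\<Sum>j. ?t (j + Suc k)) + (\<Sum>j<Suc k. ?t j)"
      using st by (rule suminf_split_initial_segment)
    have geo: "(\<lambda>j. r (j + Suc k)) sums (r k / 4)"
    proof -
      have "(\<lambda>j. (1/5 :: real) ^ j) sums (1 / (1 - 1/5))" by (intro geometric_sums) simp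
      then have "(\<lambda>j. (1/5) ^ Suc k * (1/5 :: real) ^ j) sums ((1/5) ^ Suc k * (1 / (1 - 1/5)))"
        by (rule sums_mult)
      then show ?thesis by (simp add: r_def power_add mult_ac)
    qed
    have "norm (\<Sum>j. ?t (j + Suc k)) \<le> (\<Sum>j. r (j + Suc k) * (4/3 * u k))"
      by (rule norm_suminf_le[OF t]) (intro summable_mult2 sums_summable[OF geo])
    also have "\<dots> = r k / 4 * (4/3 * u k)"
      using sums_mult2[OF geo] by (rule sums_unique[symmetric])
    finally have tail: "\<bar>\<Sum>j. ?t (j + Suc k)\<bar> \<le> r k * u k / 3" by simp
    have "r k * u k / 2 \<le> \<bar>\<Sum>j<Suc k. ?t j\<bar>" using a[of k] by (simp add: P_def)
    with tail split have "r k * u k / 6 \<le> \<bar>\<Sum>j. ?t j\<bar>" by linarith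
    moreover have "real k \<le> r k * u k / 6"
    proof -
      have "r k * (6 * real k * 5 ^ k) \<le> r k * u k"
        using nx(1)[of k] rpos[of k] by (intro mult_left_mono) (auto simp: u_def)
      moreover have "r k * (6 * real k * 5 ^ k) = 6 * real k" by (simp add: r_def power_divide)
      ultimately show ?thesis by linarith
    qed
    ultimately show ?thesis by linarith
  qed
  obtain C where "\<forall>m. \<bar>\<Sum>j. a j * f m (x j)\<bar> \<le> C"
    using sums[OF sum_a a0(1), of x] by (auto simp: bounded_iff)
  moreover obtain k where "real k > C" using reals_Archimedean2 by blast
  ultimately show False using main[of k] by (meson not_le order_trans)
qed

lemma weakly_bounded_imp_bounded:
  fixes f :: "nat \<Rightarrow> 'a::topological_space \<Rightarrow> real"
  assumes f: "\<And>n. f n \<in> Bb"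
    and bd: "\<And>\<mu>. \<mu> \<in> ca \<Longrightarrow> bounded (range (\<lambda>n. signed_integral \<mu> (f n)))"
  shows "\<exists>C. \<forall>n x. \<bar>f n x\<bar> \<le> C"
proof (rule uniform_boundedness_atomic)
  show "bounded (range (f n))" for n using f by (simp add: Bb_def)
  fix a :: "nat \<Rightarrow> real" and x :: "nat \<Rightarrow> 'a"
  assume "summable a" "\<And>k. 0 \<le> a k"
  then obtain \<mu> where "\<mu> \<in> ca" "\<And>f. f \<in> Bb \<Longrightarrow> signed_integral \<mu> f = (\<Sum>k. a k * f (x k))"
    using atomic_measure_in_ca[of a x] by blast
  then show "bounded (range (\<lambda>n. \<Sum>k. a k * f n (x k)))" using bd[of \<mu>] f by simp
qed

text \<open>Dirac measures give the pointwise limit, uniform boundedness makes it bounded, and dominated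
  convergence transfers the convergence to all integrals.\<close>

lemma weakly_Cauchy_limit:
  fixes f :: "nat \<Rightarrow> 'a::topological_space \<Rightarrow> real"
  assumes f: "\<And>n. f n \<in> Bb"
    and Cauchy: "\<And>\<mu>. \<mu> \<in> ca \<Longrightarrow> Cauchy (\<lambda>n. signed_integral \<mu> (f n))"
  obtains l where "l \<in> Bb" "\<And>x. (\<lambda>n. f n x) \<longlonglongrightarrow> l x"
    "\<And>\<mu>. \<mu> \<in> ca \<Longrightarrow> (\<lambda>n. signed_integral \<mu> (f n)) \<longlonglongrightarrow> signed_integral \<mu> l"
proof -
  obtain C where C: "\<And>n x. \<bar>f n x\<bar> \<le> C"
    using weakly_bounded_imp_bounded[of f] f Cauchy cauchy_imp_bounded by metis
  have "convergent (\<lambda>n. f n x)" for x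
  proof -
    obtain \<mu> where "\<mu> \<in> ca" "\<And>f. f \<in> Bb \<Longrightarrow> signed_integral \<mu> f = f x"
      using Dirac_in_ca by blast
    then show ?thesis using Cauchy[of \<mu>] f by (simp add: Cauchy_convergent_iff)
  qed
  then obtain l where l: "\<And>x. (\<lambda>n. f n x) \<longlonglongrightarrow> l x" unfolding convergent_def by metis
  have meas: "f n \<in> borel_measurable borel" for n using f by (simp add: Bb_def)
  have "\<bar>l x\<bar> \<le> C" for x
    using tendsto_rabs[OF l[of x]] by (rule LIMSEQ_le_const2) (use C in auto)
  then have "l \<in> Bb"
    using borel_measurable_LIMSEQ_real[OF l meas] by (auto simp: Bb_def bounded_iff)
  then show ?thesis using l tendsto_signed_integral[OF _ meas C l] by (rule that)
qed

section \<open>Convergent and Cauchy sequences in the two topologies\<close>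

lemma limitin_sigma_caI:
  assumes "l \<in> S" "\<And>n. f n \<in> S"
    and lim: "\<And>\<mu>. \<mu> \<in> ca \<Longrightarrow> (\<lambda>n. signed_integral \<mu> (f n)) \<longlonglongrightarrow> signed_integral \<mu> l"
  shows "limitin (sigma_ca S) f l sequentially"
  unfolding limitin_def
proof (intro conjI allI impI)
  fix U assume U: "openin (sigma_ca S) U \<and> l \<in> U"
  then have "openin (sigma_ca S) U" by simp
  then have "l \<in> U \<longrightarrow> (\<forall>\<^sub>F n in sequentially. f n \<in> U)"
    unfolding sigma_ca_def openin_topology_generated_by_iff
  proof induction
    case (Basis A)
    then obtain \<mu> V where A: "\<mu> \<in> ca" "open V" "A = {f \<in> S. signed_integral \<mu> f \<in> V}" by blast
    show ?case
    proof
      assume "l \<in> A"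
      then have "\<forall>\<^sub>F n in sequentially. signed_integral \<mu> (f n) \<in> V"
        using A lim[of \<mu>] by (intro topological_tendstoD) auto
      then show "\<forall>\<^sub>F n in sequentially. f n \<in> A" using assms(2) by (simp add: A(3))
    qed
  next
    case (Int A B)
    then show ?case by (auto elim: eventually_elim2)
  next
    case (UN \<U>)
    show ?case
    proof
      assume "l \<in> \<Union>\<U>"
      then obtain A where "A \<in> \<U>" "l \<in> A" by blast
      with UN have "\<forall>\<^sub>F n in sequentially. f n \<in> A" by blast
      then show "\<forall>\<^sub>F n in sequentially. f n \<in> \<Union>\<U>"
        by (rule eventually_mono) (use \<open>A \<in> \<U>\<close> in blast)
    qed
  qed simp
  with U show "\<forall>\<^sub>F n in sequentially. f n \<in> U" by simp
qed (simp add: assms(1))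

lemma Cauchy_signed_integralI:
  assumes f: "\<And>n. f n \<in> Bb" and mu: "\<mu> \<in> ca"
    and small: "\<And>r. r > 0 \<Longrightarrow> \<exists>N. \<forall>m\<ge>N. \<forall>n\<ge>N. \<bar>signed_integral \<mu> (\<lambda>x. f m x - f n x)\<bar> < r"
  shows "Cauchy (\<lambda>n. signed_integral \<mu> (f n))"
  using small by (simp add: Cauchy_def dist_real_def signed_integral_diff[OF mu f f])

lemma abs_le_seminorm_K:
  assumes "f \<in> Bb" "x \<in> K"
  shows "\<bar>f x\<bar> \<le> seminorm_K K \<mu> f"
  using cSUP_upper[OF assms(2) bdd_above_abs_Bb[OF assms(1)]] by (simp add: seminorm_K_def)

lemma seminorm_K_le:
  assumes "K \<noteq> {}" "\<And>x. x \<in> K \<Longrightarrow> \<bar>f x\<bar> \<le> a" "\<bar>signed_integral \<mu> f\<bar> \<le> b"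
  shows "seminorm_K K \<mu> f \<le> a + b"
  unfolding seminorm_K_def using assms by (intro add_mono cSUP_least)

lemma SUP_abs_nonneg:
  assumes "f \<in> Bb" "K \<noteq> {}"
  shows "0 \<le> (SUP x\<in>K. \<bar>f x\<bar>)"
proof -
  obtain x where "x \<in> K" using assms(2) by blast
  then have "\<bar>f x\<bar> \<le> (SUP x\<in>K. \<bar>f x\<bar>)"
    using bdd_above_abs_Bb[OF assms(1)] by (rule cSUP_upper)
  then show ?thesis by linarith
qed

lemma signed_integral_le_seminorm_K:
  assumes "f \<in> Bb" "K \<noteq> {}"
  shows "\<bar>signed_integral \<mu> f\<bar> \<le> seminorm_K K \<mu> f"
  using SUP_abs_nonneg[OF assms] by (simp add: seminorm_K_def)

lemma seminorm_K_triangle: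
  assumes mu: "\<mu> \<in> ca" and K: "K \<noteq> {}" and fgh: "f \<in> Bb" "g \<in> Bb" "h \<in> Bb"
  shows "seminorm_K K \<mu> (\<lambda>x. h x - f x) \<le>
    seminorm_K K \<mu> (\<lambda>x. h x - g x) + seminorm_K K \<mu> (\<lambda>x. g x - f x)"
proof -
  let ?s = "\<lambda>f. SUP x\<in>K. \<bar>f x\<bar>"
  have "\<bar>h x - f x\<bar> \<le> ?s (\<lambda>x. h x - g x) + ?s (\<lambda>x. g x - f x)" if "x \<in> K" for x
    using cSUP_upper[OF that bdd_above_abs_Bb[OF Bb_diff[OF fgh(3,2)]]]
      cSUP_upper[OF that bdd_above_abs_Bb[OF Bb_diff[OF fgh(2,1)]]] by linarith
  moreover have "\<bar>signed_integral \<mu> (\<lambda>x. h x - f x)\<bar> \<le>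
      \<bar>signed_integral \<mu> (\<lambda>x. h x - g x)\<bar> + \<bar>signed_integral \<mu> (\<lambda>x. g x - f x)\<bar>"
    using mu fgh by (simp add: signed_integral_diff)
  ultimately have "seminorm_K K \<mu> (\<lambda>x. h x - f x) \<le>
      (?s (\<lambda>x. h x - g x) + ?s (\<lambda>x. g x - f x)) +
      (\<bar>signed_integral \<mu> (\<lambda>x. h x - g x)\<bar> + \<bar>signed_integral \<mu> (\<lambda>x. g x - f x)\<bar>)"
    using K by (intro seminorm_K_le)
  then show ?thesis by (simp add: seminorm_K_def)
qed

text \<open>The definition of the topology makes seminorm balls neighbourhoods of their centres only; the
  triangle inequality makes them open. This is what allows seminorm estimates to be read off from
  convergence and from the Cauchy property.\<close>

lemma openin_tau_K_ball:
  assumes S: "S \<subseteq> Bb" and f: "f \<in> Bb" and K: "compact K" "K \<noteq> {}" and mu: "\<mu> \<in> ca"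
  shows "openin (tau_K S) {g \<in> S. seminorm_K K \<mu> (\<lambda>x. g x - f x) < r}"
  unfolding tau_K_def openin_seminorm_topology
proof (intro conjI ballI)
  fix g assume g: "g \<in> {g \<in> S. seminorm_K K \<mu> (\<lambda>x. g x - f x) < r}"
  let ?r = "r - seminorm_K K \<mu> (\<lambda>x. g x - f x)"
  have "seminorm_K K \<mu> (\<lambda>x. h x - f x) < r"
    if "h \<in> S" "seminorm_K K \<mu> (\<lambda>x. h x - g x) < ?r" for h
  proof -
    have "g \<in> Bb" "h \<in> Bb" using g that(1) S by auto
    then show ?thesis using seminorm_K_triangle[OF mu K(2) f, of g h] that(2) by simp
  qed
  then show "\<exists>F s. finite F \<and> F \<subseteq> {seminorm_K K \<mu> |K \<mu>. compact K \<and> K \<noteq> {} \<and> \<mu> \<in> ca} \<and> 0 < s \<and>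
      {h \<in> S. \<forall>p\<in>F. p (\<lambda>x. h x - g x) < s}
        \<subseteq> {g \<in> S. seminorm_K K \<mu> (\<lambda>x. g x - f x) < r}"
    using g K mu by (intro exI[of _ "{seminorm_K K \<mu>}"] exI[of _ ?r]) auto
qed auto

text \<open>The common core of the next two lemmas: uniform convergence on compact sets together with
  convergence of all integrals makes finitely many seminorms small simultaneously.\<close>

lemma eventually_seminorm_K:
  assumes f: "\<And>n. f n \<in> Bb" and l: "l \<in> Bb"
    and unif: "\<And>K. compact K \<Longrightarrow> uniform_limit K f l sequentially"
    and int: "\<And>\<mu>. \<mu> \<in> ca \<Longrightarrow> (\<lambda>n. signed_integral \<mu> (f n)) \<longlonglongrightarrow> signed_integral \<mu> l"
    and F: "finite F" "F \<subseteq> {seminorm_K K \<mu> |K \<mu>. compact K \<and> K \<noteq> {} \<and> \<mu> \<in> ca}" "r > 0"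
  shows "\<forall>\<^sub>F n in sequentially. \<forall>p\<in>F. p (\<lambda>x. f n x - l x) < r"
proof -
  have "\<forall>p\<in>F. \<forall>\<^sub>F n in sequentially. p (\<lambda>x. f n x - l x) < r"
  proof
    fix p assume "p \<in> F"
    then obtain K \<mu> where p: "p = seminorm_K K \<mu>" and K: "compact K" "K \<noteq> {}" and mu: "\<mu> \<in> ca"
      using F(2) by blast
    have "\<forall>\<^sub>F n in sequentially. \<forall>x\<in>K. dist (f n x) (l x) < r / 3"
      using unif[OF K(1)] \<open>r > 0\<close> by (intro uniform_limitD) auto
    moreover have "\<forall>\<^sub>F n in sequentially. dist (signed_integral \<mu> (f n)) (signed_integral \<mu> l) < r / 3"
      using int[OF mu] \<open>r > 0\<close> by (intro tendstoD) auto
    ultimately show "\<forall>\<^sub>F n in sequentially. p (\<lambda>x. f n x - l x) < r"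
    proof eventually_elim
      case (elim n)
      have "seminorm_K K \<mu> (\<lambda>x. f n x - l x) \<le> r / 3 + r / 3"
        using elim K by (intro seminorm_K_le)
          (auto simp: dist_real_def signed_integral_diff[OF mu f l] intro: less_imp_le)
      then show ?case using \<open>r > 0\<close> p by simp
    qed
  qed
  then show ?thesis using \<open>finite F\<close> by (simp add: eventually_ball_finite)
qed

lemma limitin_tau_KI:
  assumes S: "S \<subseteq> Bb" and f: "\<And>n. f n \<in> S" and l: "l \<in> S"
    and unif: "\<And>K. compact K \<Longrightarrow> uniform_limit K f l sequentially"
    and int: "\<And>\<mu>. \<mu> \<in> ca \<Longrightarrow> (\<lambda>n. signed_integral \<mu> (f n)) \<longlonglongrightarrow> signed_integral \<mu> l"
  shows "limitin (tau_K S) f l sequentially"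
  unfolding limitin_def
proof (intro conjI allI impI)
  show "l \<in> topspace (tau_K S)" using l by (simp add: tau_K_def)
  have B: "f n \<in> Bb" "l \<in> Bb" for n using f l S by auto
  fix U assume "openin (tau_K S) U \<and> l \<in> U"
  then obtain F r where F: "finite F" "F \<subseteq> {seminorm_K K \<mu> |K \<mu>. compact K \<and> K \<noteq> {} \<and> \<mu> \<in> ca}"
    "r > 0" and U: "{g \<in> S. \<forall>p\<in>F. p (\<lambda>x. g x - l x) < r} \<subseteq> U"
    unfolding tau_K_def openin_seminorm_topology by meson
  have "\<forall>\<^sub>F n in sequentially. \<forall>p\<in>F. p (\<lambda>x. f n x - l x) < r"
    by (rule eventually_seminorm_K[OF B unif int F])
  then show "\<forall>\<^sub>F n in sequentially. f n \<in> U"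
    by (rule eventually_mono) (use U f in blast)
qed

text \<open>The limit \<open>l\<close> may lie outside \<open>S\<close>; in this form the lemma can detect that \<open>S\<close> is not complete.\<close>

lemma tvs_Cauchy_tau_KI:
  assumes S: "S \<subseteq> Bb" and diff: "\<And>f g. f \<in> S \<Longrightarrow> g \<in> S \<Longrightarrow> (\<lambda>x. f x - g x) \<in> S"
    and f: "\<And>n. f n \<in> S" and l: "l \<in> Bb"
    and unif: "\<And>K. compact K \<Longrightarrow> uniform_limit K f l sequentially"
    and int: "\<And>\<mu>. \<mu> \<in> ca \<Longrightarrow> (\<lambda>n. signed_integral \<mu> (f n)) \<longlonglongrightarrow> signed_integral \<mu> l"
  shows "tvs_Cauchy (tau_K S) f"
  unfolding tvs_Cauchy_def
proof (intro conjI allI impI)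
  show "range f \<subseteq> topspace (tau_K S)" using f by (auto simp: tau_K_def)
  have B: "f n \<in> Bb" for n using f S by auto
  fix U assume "openin (tau_K S) U \<and> (\<lambda>_. 0) \<in> U"
  then have "\<exists>F r. finite F \<and> F \<subseteq> {seminorm_K K \<mu> |K \<mu>. compact K \<and> K \<noteq> {} \<and> \<mu> \<in> ca} \<and> 0 < r \<and>
      {g \<in> S. \<forall>p\<in>F. p (\<lambda>x. g x - 0) < r} \<subseteq> U"
    unfolding tau_K_def openin_seminorm_topology by fast
  then obtain F r where F: "finite F" "F \<subseteq> {seminorm_K K \<mu> |K \<mu>. compact K \<and> K \<noteq> {} \<and> \<mu> \<in> ca}"
    and r: "r > 0" and U: "{g \<in> S. \<forall>p\<in>F. p (\<lambda>x. g x - 0) < r} \<subseteq> U"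
    by blast
  have "\<forall>\<^sub>F n in sequentially. \<forall>p\<in>F. p (\<lambda>x. f n x - l x) < r / 2"
    by (rule eventually_seminorm_K[OF B l unif int F half_gt_zero[OF r]])
  then obtain N where N: "\<And>n p. n \<ge> N \<Longrightarrow> p \<in> F \<Longrightarrow> p (\<lambda>x. f n x - l x) < r / 2"
    by (auto simp: eventually_sequentially)
  have "p (\<lambda>x. f m x - f n x) < r" if mn: "m \<ge> N" "n \<ge> N" and p: "p \<in> F" for m n p
  proof -
    obtain K \<mu> where p': "p = seminorm_K K \<mu>" "K \<noteq> {}" "\<mu> \<in> ca" using F(2) p by blast
    have "p (\<lambda>x. f m x - f n x) \<le> p (\<lambda>x. f m x - l x) + p (\<lambda>x. l x - f n x)"
      unfolding p'(1) by (rule seminorm_K_triangle[OF p'(3,2) B l B])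
    moreover have "p (\<lambda>x. l x - f n x) = p (\<lambda>x. f n x - l x)"
      by (simp add: p'(1) seminorm_K_def signed_integral_diff[OF p'(3) l B]
          signed_integral_diff[OF p'(3) B l] abs_minus_commute)
    ultimately show ?thesis using N[OF mn(1) p] N[OF mn(2) p] by linarith
  qed
  then have "(\<lambda>x. f m x - f n x) \<in> U" if "m \<ge> N" "n \<ge> N" for m n
    using that U diff[OF f f] by (simp add: subset_iff)
  then show "\<exists>N. \<forall>m\<ge>N. \<forall>n\<ge>N. (\<lambda>x. f m x - f n x) \<in> U" by blast
qed

lemma limitin_tau_KD:
  assumes S: "S \<subseteq> Bb" and f: "\<And>n. f n \<in> S" and lim: "limitin (tau_K S) f l sequentially"
  shows "l \<in> S" "(\<lambda>n. f n x) \<longlonglongrightarrow> l x"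
    and "\<mu> \<in> ca \<Longrightarrow> (\<lambda>n. signed_integral \<mu> (f n)) \<longlonglongrightarrow> signed_integral \<mu> l"
proof -
  show l: "l \<in> S" using lim by (simp add: limitin_def tau_K_def)
  have fl: "(\<lambda>x. f n x - l x) \<in> Bb" for n using f l S by (intro Bb_diff) auto
  have small: "\<forall>\<^sub>F n in sequentially. seminorm_K {x} \<mu> (\<lambda>x. f n x - l x) < r"
    if mu: "\<mu> \<in> ca" and r: "r > 0" for \<mu> x r
  proof -
    let ?U = "{g \<in> S. seminorm_K {x} \<mu> (\<lambda>x. g x - l x) < r}"
    have "openin (tau_K S) ?U" using S l mu by (intro openin_tau_K_ball) auto
    moreover have "l \<in> ?U" using l r by (simp add: seminorm_K_def)
    ultimately have "\<forall>\<^sub>F n in sequentially. f n \<in> ?U" using lim unfolding limitin_def by blast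
    then show ?thesis by (rule eventually_mono) simp
  qed
  show "(\<lambda>n. f n x) \<longlonglongrightarrow> l x"
  proof (rule tendstoI)
    fix r :: real assume "r > 0"
    show "\<forall>\<^sub>F n in sequentially. dist (f n x) (l x) < r"
      using small[OF zero_in_ca \<open>r > 0\<close>, of x]
    proof eventually_elim
      case (elim n)
      then show ?case using abs_le_seminorm_K[OF fl[of n], where x = x and K = "{x}" and \<mu> = "\<lambda>_. 0"]
        by (simp add: dist_real_def)
    qed
  qed
  show "(\<lambda>n. signed_integral \<mu> (f n)) \<longlonglongrightarrow> signed_integral \<mu> l" if mu: "\<mu> \<in> ca"
  proof (rule tendstoI)
    fix r :: real assume "r > 0"
    show "\<forall>\<^sub>F n in sequentially. dist (signed_integral \<mu> (f n)) (signed_integral \<mu> l) < r"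
      using small[OF mu \<open>r > 0\<close>, of x]
    proof eventually_elim
      case (elim n)
      have "f n \<in> Bb" "l \<in> Bb" using f l S by auto
      then show ?case using elim signed_integral_le_seminorm_K[OF fl[of n], where K = "{x}" and \<mu> = \<mu>] mu
        by (simp add: dist_real_def signed_integral_diff)
    qed
  qed
qed

lemma tvs_Cauchy_tau_KD:
  assumes S: "S \<subseteq> Bb" "(\<lambda>_. 0) \<in> S" and C: "tvs_Cauchy (tau_K S) f"
  shows "f n \<in> S" "\<mu> \<in> ca \<Longrightarrow> Cauchy (\<lambda>n. signed_integral \<mu> (f n))"
    and "compact K \<Longrightarrow> uniformly_Cauchy_on K f"
proof -
  show fS: "f n \<in> S" for n using C by (auto simp: tvs_Cauchy_def tau_K_def)
  then have fB: "f n \<in> Bb" for n using S by blast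
  have small: "\<exists>N. \<forall>m\<ge>N. \<forall>n\<ge>N. seminorm_K K \<mu> (\<lambda>x. f m x - f n x) < r"
    if K: "compact K" "K \<noteq> {}" and mu: "\<mu> \<in> ca" and r: "r > 0" for K \<mu> r
  proof -
    let ?U = "{g \<in> S. seminorm_K K \<mu> (\<lambda>x. g x - 0) < r}"
    have "openin (tau_K S) ?U" using S K mu by (intro openin_tau_K_ball) auto
    moreover have "(\<lambda>_. 0) \<in> ?U" using S K r by (simp add: seminorm_K_def)
    ultimately obtain N where "\<forall>m\<ge>N. \<forall>n\<ge>N. (\<lambda>x. f m x - f n x) \<in> ?U"
      using C unfolding tvs_Cauchy_def by meson
    then show ?thesis by (intro exI[of _ N]) simp
  qed
  show "Cauchy (\<lambda>n. signed_integral \<mu> (f n))" if mu: "\<mu> \<in> ca"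
  proof (rule Cauchy_signed_integralI[OF fB mu])
    fix r :: real assume "r > 0"
    (* any nonempty compact set serves, as only the integral part of the seminorm matters here *)
    then obtain N where "\<forall>m\<ge>N. \<forall>n\<ge>N. seminorm_K {undefined} \<mu> (\<lambda>x. f m x - f n x) < r"
      using small[of "{undefined}", OF _ _ mu \<open>r > 0\<close>] by auto
    then show "\<exists>N. \<forall>m\<ge>N. \<forall>n\<ge>N. \<bar>signed_integral \<mu> (\<lambda>x. f m x - f n x)\<bar> < r"
      using le_less_trans[OF signed_integral_le_seminorm_K[OF Bb_diff[OF fB fB], where K = "{undefined}" and \<mu> = \<mu>]]
      by blast
  qed
  show "uniformly_Cauchy_on K f" if K: "compact K"
  proof (cases "K = {}")
    case False
      show ?thesis
      unfolding uniformly_Cauchy_on_def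
    proof (intro allI impI)
      fix r :: real assume "r > 0"
      then obtain N where "\<forall>m\<ge>N. \<forall>n\<ge>N. seminorm_K K (\<lambda>_. 0) (\<lambda>x. f m x - f n x) < r"
        using small[OF K False zero_in_ca] by blast
      then show "\<exists>M. \<forall>x\<in>K. \<forall>m\<ge>M. \<forall>n\<ge>M. dist (f m x) (f n x) < r"
        using le_less_trans[OF abs_le_seminorm_K[OF Bb_diff[OF fB fB], where K = K and \<mu> = "\<lambda>_. 0"]]
        unfolding dist_real_def by blast
    qed
  qed (simp add: uniformly_Cauchy_on_def)
qed

lemma tvs_Cauchy_tau_K_limit:
  assumes S: "S \<subseteq> Bb" "(\<lambda>_. 0) \<in> S" and C: "tvs_Cauchy (tau_K S) f"
  obtains l where "l \<in> Bb" "\<And>K. compact K \<Longrightarrow> uniform_limit K f l sequentially"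
    "\<And>\<mu>. \<mu> \<in> ca \<Longrightarrow> (\<lambda>n. signed_integral \<mu> (f n)) \<longlonglongrightarrow> signed_integral \<mu> l"
proof -
  note D = tvs_Cauchy_tau_KD[OF S C]
  have fB: "f n \<in> Bb" for n using D(1) S by blast
  obtain l where l: "l \<in> Bb" "\<And>x. (\<lambda>n. f n x) \<longlonglongrightarrow> l x"
    "\<And>\<mu>. \<mu> \<in> ca \<Longrightarrow> (\<lambda>n. signed_integral \<mu> (f n)) \<longlonglongrightarrow> signed_integral \<mu> l"
    using weakly_Cauchy_limit[of f, OF fB D(2)] by blast
  have "uniform_limit K f l sequentially" if K: "compact K" for K
  proof -
    have "uniformly_convergent_on K f"
      using D(3)[OF K] by (rule Cauchy_uniformly_convergent)
    then obtain l' where l': "uniform_limit K f l' sequentially"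
      by (auto simp: uniformly_convergent_on_def)
    then have "l' x = l x" if "x \<in> K" for x
      using tendsto_uniform_limitI[OF l' that] l(2) LIMSEQ_unique by blast
    then show ?thesis using l' by (simp cong: uniform_limit_cong')
  qed
  with l(1,3) show ?thesis by (intro that)
qed

section \<open>Lipschitz approximation\<close>

text \<open>Stronger than uniform continuity on \<open>K\<close>, as \<open>y\<close> ranges over the whole space. A Lebesgue number of
  the cover of \<open>K\<close> by preimages of small intervals is a suitable \<open>d\<close>.\<close>

lemma continuous_uniform_near_compact:
  fixes f :: "'a::metric_space \<Rightarrow> real"
  assumes f: "continuous_on UNIV f" and K: "compact K" and e: "e > 0"
  obtains d where "d > 0" "\<And>x y. x \<in> K \<Longrightarrow> dist x y < d \<Longrightarrow> \<bar>f x - f y\<bar> < e"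
proof -
  let ?G = "range (\<lambda>c. f -` ball c (e / 2))"
  have "open G" if "G \<in> ?G" for G
    using that f by (auto intro: open_vimage)
  moreover have "K \<subseteq> \<Union>?G"
  proof
    fix x
    have "x \<in> f -` ball (f x) (e / 2)" using e by simp
    then show "x \<in> \<Union>?G" by blast
  qed
  ultimately obtain d where d: "d > 0" "\<And>x. x \<in> K \<Longrightarrow> \<exists>G\<in>?G. ball x d \<subseteq> G"
    using Heine_Borel_lemma[OF K, of ?G] by metis
  have "\<bar>f x - f y\<bar> < e" if xy: "x \<in> K" "dist x y < d" for x y
  proof -
    obtain c where c: "ball x d \<subseteq> f -` ball c (e / 2)" using d(2)[OF xy(1)] by blast
    have "x \<in> ball x d" "y \<in> ball x d" using d(1) xy(2) by auto
    then have "f x \<in> ball c (e / 2)" "f y \<in> ball c (e / 2)" using c by blast+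
    then have "\<bar>c - f x\<bar> < e / 2" "\<bar>c - f y\<bar> < e / 2" by (simp_all add: dist_real_def)
    then show ?thesis by linarith
  qed
  with d(1) show ?thesis by (rule that)
qed

text \<open>The approximants are \<open>g n x = inf\<^sub>y (f y + n * dist x y)\<close>, the largest \<open>n\<close>-Lipschitz minorants of
  \<open>f\<close>. They inherit the bound \<open>C\<close> of \<open>f\<close>. Points \<open>y\<close> with \<open>dist x y \<ge> d\<close> do not matter for the infimum
  once \<open>n * d \<ge> 2 * C\<close>, and on the nearby ones \<open>f\<close> varies little, uniformly for \<open>x\<close> in a compact set.\<close>

lemma Lipschitz_approximation:
  fixes f :: "'a::metric_space \<Rightarrow> real"
  assumes f: "f \<in> Cb"
  obtains g where "\<And>n. g n \<in> UCb" "\<And>K. compact K \<Longrightarrow> uniform_limit K g f sequentially"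
    "\<And>\<mu>. \<mu> \<in> ca \<Longrightarrow> (\<lambda>n. signed_integral \<mu> (g n)) \<longlonglongrightarrow> signed_integral \<mu> f"
proof -
  obtain C where C: "\<And>x. \<bar>f x\<bar> \<le> C" using f Cb_subset_Bb Bb_bound[of f] by blast
  define g where "g n x = (INF y. f y + real n * dist x y)" for n x
  have lower: "- C \<le> f y + real n * dist x y" for n x y
  proof -
    have "- C \<le> f y" using C[of y] by linarith
    then show ?thesis by (simp add: add_increasing2)
  qed
  have bdd: "bdd_below (range (\<lambda>y. f y + real n * dist x y))" for n x
    using lower by (intro bdd_belowI[of _ "- C"]) auto
  have g_le: "g n x \<le> f y + real n * dist x y" for n x y
    unfolding g_def using bdd by (rule cINF_lower) simp
  have le_g: "a \<le> g n x" if "\<And>y. a \<le> f y + real n * dist x y" for a n x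
    unfolding g_def using that by (intro cINF_greatest) auto
  have g_C: "\<bar>g n x\<bar> \<le> C" for n x
    using g_le[of n x x] le_g[of "- C", OF lower, of n x] C[of x] by simp
  have "g n x - real n * dist x z \<le> g n z" for n x z
  proof (rule le_g)
    fix y
    have "real n * dist x y \<le> real n * (dist x z + dist z y)"
      by (intro mult_left_mono dist_triangle) auto
    then show "g n x - real n * dist x z \<le> f y + real n * dist z y"
      using g_le[of n x y] by (simp add: distrib_left)
  qed
  then have "\<bar>g n x - g n z\<bar> \<le> real n * dist x z" for n x z
    by (simp add: abs_le_iff algebra_simps) (metis add.commute dist_commute)
  then have gU: "g n \<in> UCb" for n
    using g_C by (intro Lipschitz_in_UCb[of "real n" _ C]) auto
  have unif: "uniform_limit K g f sequentially" if K: "compact K" for K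
  proof (rule uniform_limitI)
    fix e :: real assume e: "e > 0"
    have "e / 2 > 0" "continuous_on UNIV f" using e f by (auto simp: Cb_def)
    then obtain d where d: "d > 0" "\<And>x y. x \<in> K \<Longrightarrow> dist x y < d \<Longrightarrow> \<bar>f x - f y\<bar> < e / 2"
      using continuous_uniform_near_compact K by metis
    obtain N where N: "2 * C / d \<le> real N" using real_arch_simple by blast
    have "dist (g n x) (f x) < e" if n: "n \<ge> N" and x: "x \<in> K" for n x
    proof -
      have "f x - e / 2 \<le> g n x"
      proof (rule le_g)
        fix y
        show "f x - e / 2 \<le> f y + real n * dist x y"
        proof (cases "dist x y < d")
          case True
          have "0 \<le> real n * dist x y" by simp
          then show ?thesis using d(2)[OF x True] by linarith
        next
          case False
          have "2 * C \<le> real N * d" using N d(1) by (simp add: field_simps)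
          also have "\<dots> \<le> real n * dist x y" using False n d(1) by (intro mult_mono) auto
          finally show ?thesis using C[of x] C[of y] e by linarith
        qed
      qed
      then show ?thesis using g_le[of n x x] e by (simp add: dist_real_def)
    qed
    then show "\<forall>\<^sub>F n in sequentially. \<forall>x\<in>K. dist (g n x) (f x) < e"
      by (auto simp: eventually_sequentially)
  qed
  have meas: "g n \<in> borel_measurable borel" for n
    using gU UCb_subset_Cb Cb_subset_Bb by (fastforce simp: Bb_def)
  have "(\<lambda>n. g n x) \<longlonglongrightarrow> f x" for x
    by (rule tendsto_uniform_limitI[OF unif[of "{x}"]]) auto
  from tendsto_signed_integral[OF _ meas g_C this] show ?thesis
    using that[OF gU unif] by blast
qed

section \<open>Completeness and density\<close>

theorem sequentially_complete_sigma_ca: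
  "sequentially_complete (sigma_ca (Bb :: ('a::topological_space \<Rightarrow> real) set))"
  unfolding sequentially_complete_def
proof (intro allI impI)
  fix f :: "nat \<Rightarrow> 'a \<Rightarrow> real"
  assume C: "tvs_Cauchy (sigma_ca Bb) f"
  then have f: "f n \<in> Bb" for n by (auto simp: tvs_Cauchy_def)
  have "Cauchy (\<lambda>n. signed_integral \<mu> (f n))" if mu: "\<mu> \<in> ca" for \<mu>
  proof (rule Cauchy_signed_integralI[OF f mu])
    fix r :: real assume "r > 0"
    let ?U = "{g \<in> Bb. signed_integral \<mu> g \<in> {- r<..<r}}"
    have "openin (sigma_ca Bb) ?U"
      unfolding sigma_ca_def using mu
      by (intro topology_generated_by_Basis CollectI exI[of _ \<mu>] exI[of _ "{- r<..<r}"]) auto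
    moreover have "(\<lambda>_. 0) \<in> ?U" using \<open>r > 0\<close> by (simp add: Bb_def)
    ultimately obtain N where "\<forall>m\<ge>N. \<forall>n\<ge>N. (\<lambda>x. f m x - f n x) \<in> ?U"
      using C unfolding tvs_Cauchy_def by meson
    then show "\<exists>N. \<forall>m\<ge>N. \<forall>n\<ge>N. \<bar>signed_integral \<mu> (\<lambda>x. f m x - f n x)\<bar> < r"
      by (intro exI[of _ N]) (simp add: abs_less_iff minus_less_iff)
  qed
  then obtain l where "l \<in> Bb" "\<And>x. (\<lambda>n. f n x) \<longlonglongrightarrow> l x"
    "\<And>\<mu>. \<mu> \<in> ca \<Longrightarrow> (\<lambda>n. signed_integral \<mu> (f n)) \<longlonglongrightarrow> signed_integral \<mu> l"
    using weakly_Cauchy_limit[of f, OF f] by blast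
  then have "limitin (sigma_ca Bb) f l sequentially" using f by (intro limitin_sigma_caI)
  then show "\<exists>l. limitin (sigma_ca Bb) f l sequentially" by blast
qed

text \<open>If \<open>f\<close> is discontinuous at \<open>x\<close>, some sequence \<open>y n \<longlonglongrightarrow> x\<close> satisfies \<open>\<bar>f (y n) - f x\<bar> \<ge> e\<close> for all
  \<open>n\<close>. A function within \<open>e/3\<close> of \<open>f\<close> on the compact set consisting of \<open>x\<close> and all \<open>y n\<close> is then
  discontinuous at \<open>x\<close> as well.\<close>

theorem closedin_tau_K_Cb:
  "closedin (tau_K (Bb :: ('a::metric_space \<Rightarrow> real) set)) Cb"
proof -
  have "\<exists>F r. finite F \<and> F \<subseteq> {seminorm_K K \<mu> |K \<mu>. compact K \<and> K \<noteq> {} \<and> \<mu> \<in> ca} \<and> 0 < r \<and>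
      {g \<in> Bb. \<forall>p\<in>F. p (\<lambda>x. g x - f x) < r} \<subseteq> Bb - Cb"
    if f: "f \<in> Bb - Cb" for f :: "'a \<Rightarrow> real"
  proof -
    have "\<not> continuous_on UNIV f" using f by (auto simp: Bb_def Cb_def)
    then obtain x where "\<not> isCont f x" by (auto simp: continuous_on_eq_continuous_at)
    then obtain e where e: "e > 0" "\<And>d. d > 0 \<Longrightarrow> \<exists>y. dist y x < d \<and> \<not> dist (f y) (f x) < e"
      unfolding continuous_at_eps_delta by blast
    have "\<exists>y. dist y x < 1 / real (Suc n) \<and> \<not> dist (f y) (f x) < e" for n
      by (rule e(2)) simp
    then obtain y where y: "\<And>n. dist (y n) x < 1 / real (Suc n)" "\<And>n. \<not> dist (f (y n)) (f x) < e"
      by metis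
    have lim: "y \<longlonglongrightarrow> x"
    proof (rule metric_tendsto_imp_tendsto[where f = "\<lambda>n. 1 / real (Suc n)" and a = 0])
      show "(\<lambda>n. 1 / real (Suc n)) \<longlonglongrightarrow> 0" by (rule LIMSEQ_Suc[OF lim_1_over_n])
      show "\<forall>\<^sub>F n in sequentially. dist (y n) x \<le> dist (1 / real (Suc n)) 0"
        using y(1) by (intro always_eventually allI less_imp_le) simp
    qed
    define K where "K = insert x (range y)"
    have K: "compact K" "K \<noteq> {}"
      using compactin_sequence_with_limit[of euclidean y x "range y"] lim by (simp_all add: K_def)
    have "g \<notin> Cb" if g: "g \<in> Bb" "seminorm_K K (\<lambda>_. 0) (\<lambda>x. g x - f x) < e / 3" for g
    proof
      assume "g \<in> Cb"
      then have "(\<lambda>n. g (y n)) \<longlonglongrightarrow> g x"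
        using lim by (auto simp: Cb_def continuous_on_eq_continuous_at intro: isCont_tendsto_compose)
      then have "\<forall>\<^sub>F n in sequentially. dist (g (y n)) (g x) < e / 3"
        using e(1) by (intro tendstoD) auto
      then obtain n where n: "dist (g (y n)) (g x) < e / 3" by (auto simp: eventually_sequentially)
      have gf: "(\<lambda>x. g x - f x) \<in> Bb" using g(1) f by (auto intro: Bb_diff)
      have "\<bar>g z - f z\<bar> < e / 3" if "z \<in> K" for z
        using abs_le_seminorm_K[OF gf that, of "\<lambda>_. 0"] g(2) by linarith
      then have "\<bar>g (y n) - f (y n)\<bar> < e / 3" "\<bar>g x - f x\<bar> < e / 3" by (simp_all add: K_def)
      then show False using n y(2)[of n] unfolding dist_real_def by linarith
    qed
    then show ?thesis
      using K zero_in_ca e(1)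
      by (intro exI[of _ "{seminorm_K K (\<lambda>_. 0)}"] exI[of _ "e / 3"]) auto
  qed
  then have "openin (tau_K Bb) (Bb - Cb :: ('a \<Rightarrow> real) set)"
    unfolding tau_K_def openin_seminorm_topology by blast
  moreover have "Cb \<subseteq> (Bb :: ('a \<Rightarrow> real) set)" by (rule Cb_subset_Bb)
  ultimately show ?thesis by (simp add: closedin_def tau_K_def)
qed

lemma sequentially_complete_tau_K:
  fixes S :: "('a::topological_space \<Rightarrow> real) set"
  assumes "closedin (tau_K Bb) S" "(\<lambda>_. 0) \<in> S"
  shows "sequentially_complete (tau_K S)"
  unfolding sequentially_complete_def
proof (intro allI impI)
  have S: "S \<subseteq> Bb" using closedin_subset[OF assms(1)] by (simp add: tau_K_def)
  fix f assume C: "tvs_Cauchy (tau_K S) f"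
  then have f: "f n \<in> S" for n by (rule tvs_Cauchy_tau_KD(1)[OF S assms(2)])
  then have fB: "f n \<in> Bb" for n using S by blast
  obtain l where l: "l \<in> Bb" and unif: "\<And>K. compact K \<Longrightarrow> uniform_limit K f l sequentially"
    and int: "\<And>\<mu>. \<mu> \<in> ca \<Longrightarrow> (\<lambda>n. signed_integral \<mu> (f n)) \<longlonglongrightarrow> signed_integral \<mu> l"
    using tvs_Cauchy_tau_K_limit[OF S assms(2) C] by blast
  have "limitin (tau_K Bb) f l sequentially"
    by (rule limitin_tau_KI[OF order_refl fB l unif int])
  then have "l \<in> S" using assms(1) f by (intro limitin_closedin[where X = "tau_K Bb"]) auto
  then have "limitin (tau_K S) f l sequentially"
    by (rule limitin_tau_KI[OF S f _ unif int])
  then show "\<exists>l. limitin (tau_K S) f l sequentially" by blast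
qed

corollary sequentially_complete_tau_K_Bb: "sequentially_complete (tau_K Bb)"
proof (rule sequentially_complete_tau_K)
  show "closedin (tau_K Bb) Bb"
    using closedin_topspace[of "tau_K Bb"] by (simp add: tau_K_def)
qed (simp add: Bb_def)

corollary sequentially_complete_tau_K_Cb:
  "sequentially_complete (tau_K (Cb :: ('a::metric_space \<Rightarrow> real) set))"
  using closedin_tau_K_Cb by (rule sequentially_complete_tau_K) (simp add: Cb_def)

theorem UCb_dense_in_Cb:
  "tau_K Cb closure_of UCb = (Cb :: ('a::metric_space \<Rightarrow> real) set)"
proof
  show "tau_K Cb closure_of UCb \<subseteq> Cb"
    using closure_of_subset_topspace[of "tau_K Cb" UCb] by (simp add: tau_K_def)
  show "Cb \<subseteq> tau_K Cb closure_of (UCb :: ('a \<Rightarrow> real) set)"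
  proof
    fix f :: "'a \<Rightarrow> real" assume f: "f \<in> Cb"
    obtain g where g: "\<And>n. g n \<in> UCb" and
      lim: "\<And>K. compact K \<Longrightarrow> uniform_limit K g f sequentially"
      "\<And>\<mu>. \<mu> \<in> ca \<Longrightarrow> (\<lambda>n. signed_integral \<mu> (g n)) \<longlonglongrightarrow> signed_integral \<mu> f"
      using Lipschitz_approximation[OF f] by blast
    have gC: "g n \<in> Cb" for n using g UCb_subset_Cb by blast
    have "limitin (tau_K Cb) g f sequentially"
      by (rule limitin_tau_KI[OF Cb_subset_Bb gC f lim])
    moreover have "\<forall>\<^sub>F n in sequentially. g n \<in> tau_K Cb closure_of UCb"
      using g closure_of_subset[of UCb "tau_K Cb"] UCb_subset_Cb
      by (intro always_eventually allI) (auto simp: tau_K_def)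
    ultimately show "f \<in> tau_K Cb closure_of UCb"
      by (intro limitin_closedin[where X = "tau_K Cb"]) auto
  qed
qed

text \<open>The Lipschitz regularizations of a bounded continuous \<open>f\<close> form a Cauchy sequence of uniformly
  continuous functions, whose only possible limit is \<open>f\<close>.\<close>

theorem UCb_complete_iff:
  "sequentially_complete (tau_K (UCb :: ('a::metric_space \<Rightarrow> real) set)) \<longleftrightarrow>
   (UCb :: ('a \<Rightarrow> real) set) = Cb"
proof
  assume complete: "sequentially_complete (tau_K (UCb :: ('a \<Rightarrow> real) set))"
  have UB: "(UCb :: ('a \<Rightarrow> real) set) \<subseteq> Bb" using UCb_subset_Cb Cb_subset_Bb by blast
  have "f \<in> UCb" if f: "f \<in> Cb" for f :: "'a \<Rightarrow> real"
  proof -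
    obtain g where g: "\<And>n. g n \<in> UCb" and
      lim: "\<And>K. compact K \<Longrightarrow> uniform_limit K g f sequentially"
      "\<And>\<mu>. \<mu> \<in> ca \<Longrightarrow> (\<lambda>n. signed_integral \<mu> (g n)) \<longlonglongrightarrow> signed_integral \<mu> f"
      using Lipschitz_approximation[OF f] by blast
    have "f \<in> Bb" using f Cb_subset_Bb by blast
    then have "tvs_Cauchy (tau_K UCb) g"
      using tvs_Cauchy_tau_KI[OF UB UCb_diff g _ lim] by blast
    then obtain l where l: "limitin (tau_K UCb) g l sequentially"
      using complete by (auto simp: sequentially_complete_def)
    note D = limitin_tau_KD[OF UB g l]
    have "f x = l x" for x
      using tendsto_uniform_limitI[OF lim(1)[of "{x}"], of x] D(2)[of x] LIMSEQ_unique by auto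
    then have "f = l" by auto
    then show ?thesis using D(1) by simp
  qed
  then show "(UCb :: ('a \<Rightarrow> real) set) = Cb" using UCb_subset_Cb by blast
next
  assume "(UCb :: ('a \<Rightarrow> real) set) = Cb"
  then show "sequentially_complete (tau_K (UCb :: ('a \<Rightarrow> real) set))"
    using sequentially_complete_tau_K_Cb[where 'a = 'a] by simp
qed

section \<open>Metrizability\<close>

text \<open>The sup-norm is the seminorm for \<open>K = UNIV\<close> and \<open>\<mu> = 0\<close>, and every other seminorm is at most
  \<open>1 + c\<close> times the sup-norm, where \<open>c\<close> bounds the total variation of its measure.\<close>

lemma metrizable_tau_K_if_compact:
  fixes S :: "('a::topological_space \<Rightarrow> real) set"
  assumes S: "S \<subseteq> Bb" and compact: "compact (UNIV :: 'a set)"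
  shows "metrizable_space (tau_K S)"
proof -
  (* the outer absolute value keeps d nonnegative where the supremum is not a sup-norm distance,
     since Metric_space asks for this on the whole type *)
  define d where "d f g = \<bar>SUP x. \<bar>f x - g x\<bar>\<bar>" for f g :: "'a \<Rightarrow> real"
  have B: "(\<lambda>x. f x - g x) \<in> Bb" if "f \<in> S" "g \<in> S" for f g
    using that S by (intro Bb_diff) auto
  have d_eq: "d f g = (SUP x. \<bar>f x - g x\<bar>)" if "f \<in> S" "g \<in> S" for f g
    using SUP_abs_nonneg[OF B[OF that], of UNIV] by (simp add: d_def)
  have le_d: "\<bar>f x - g x\<bar> \<le> d f g" if "f \<in> S" "g \<in> S" for f g x
    unfolding d_eq[OF that] using bdd_above_abs_Bb[OF B[OF that]] by (intro cSUP_upper) auto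
  have d_le: "d f g \<le> c" if "f \<in> S" "g \<in> S" "\<And>x. \<bar>f x - g x\<bar> \<le> c" for f g c
    unfolding d_eq[OF that(1,2)] using that(3) by (intro cSUP_least) auto
  interpret Metric_space S d
  proof
    show "0 \<le> d f g" "d f g = d g f" for f g by (simp_all add: d_def abs_minus_commute)
    show "(d f g = 0) = (f = g)" if "f \<in> S" "g \<in> S" for f g
    proof
      assume "d f g = 0"
      then have "f x = g x" for x using le_d[OF that, of x] by simp
      then show "f = g" by auto
    qed (simp add: d_def)
    show "d f h \<le> d f g + d g h" if "f \<in> S" "g \<in> S" "h \<in> S" for f g h
    proof (rule d_le[OF that(1,3)])
      show "\<bar>f x - h x\<bar> \<le> d f g + d g h" for x
        using le_d[OF that(1,2), of x] le_d[OF that(2,3), of x] by linarith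
    qed
  qed
  let ?P = "{seminorm_K K \<mu> |K \<mu>. compact K \<and> K \<noteq> {} \<and> \<mu> \<in> ca} :: (('a \<Rightarrow> real) \<Rightarrow> real) set"
  have "\<exists>c\<ge>0. \<forall>f\<in>S. \<forall>g\<in>S. p (\<lambda>x. g x - f x) \<le> c * d f g" if P: "p \<in> ?P" for p
  proof -
    obtain K \<mu> where p: "p = seminorm_K K \<mu>" "K \<noteq> {}" "\<mu> \<in> ca" using P by blast
    obtain c where c: "c \<ge> 0" "\<And>f C. f \<in> Bb \<Longrightarrow> \<forall>x. \<bar>f x\<bar> \<le> C \<Longrightarrow> \<bar>signed_integral \<mu> f\<bar> \<le> c * C"
      using signed_integral_le[OF p(3)] by blast
    have "p (\<lambda>x. g x - f x) \<le> (1 + c) * d f g" if "f \<in> S" "g \<in> S" for f g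
    proof -
      have le: "\<bar>g x - f x\<bar> \<le> d f g" for x using le_d[OF that] by (simp add: abs_minus_commute)
      have "p (\<lambda>x. g x - f x) \<le> d f g + c * d f g"
        unfolding p(1) using p(2) le B[OF that(2,1)] by (intro seminorm_K_le c(2)) auto
      then show ?thesis by (simp add: distrib_right)
    qed
    then show ?thesis using c(1) by (intro exI[of _ "1 + c"]) auto
  qed
  then have "\<forall>p\<in>?P. \<exists>c\<ge>0. \<forall>f\<in>S. \<forall>g\<in>S. p (\<lambda>x. g x - f x) \<le> c * d f g" by (rule ballI)
  from bchoice[OF this] obtain c
    where "\<forall>p\<in>?P. 0 \<le> c p \<and> (\<forall>f\<in>S. \<forall>g\<in>S. p (\<lambda>x. g x - f x) \<le> c p * d f g)"
    by (elim exE)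
  then have c: "\<And>p. p \<in> ?P \<Longrightarrow> 0 \<le> c p"
    "\<And>p f g. p \<in> ?P \<Longrightarrow> f \<in> S \<Longrightarrow> g \<in> S \<Longrightarrow> p (\<lambda>x. g x - f x) \<le> c p * d f g"
    by simp_all
  have "openin (tau_K S) U \<longleftrightarrow> openin mtopology U" for U
  proof
    assume U: "openin (tau_K S) U"
    have "\<exists>r>0. mball f r \<subseteq> U" if f: "f \<in> U" for f
    proof -
      have fS: "f \<in> S" using f U by (auto simp: tau_K_def openin_seminorm_topology)
      obtain F r where F: "finite F" "F \<subseteq> ?P" "r > 0"
        "{g \<in> S. \<forall>p\<in>F. p (\<lambda>x. g x - f x) < r} \<subseteq> U"
        using f U unfolding tau_K_def openin_seminorm_topology by meson
      define C where "C = 1 + (\<Sum>p\<in>F. c p)"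
      have cF: "0 \<le> c p" if "p \<in> F" for p using c(1) F(2) that by blast
      then have sum: "0 \<le> (\<Sum>p\<in>F. c p)" by (rule sum_nonneg)
      have "p (\<lambda>x. g x - f x) < r" if p: "p \<in> F" and g: "g \<in> S" "d f g < r / C" for p g
      proof -
        have pP: "p \<in> ?P" using p F(2) by blast
        have "c p \<le> (\<Sum>p\<in>F. c p)"
          using cF F(1) p by (intro member_le_sum) auto
        then have "c p \<le> C" by (simp add: C_def)
        have "p (\<lambda>x. g x - f x) \<le> c p * d f g" by (rule c(2)[OF pP fS g(1)])
        also have "\<dots> \<le> C * d f g" using \<open>c p \<le> C\<close> by (intro mult_right_mono) auto
        also have "\<dots> < r" using g(2) sum by (simp add: C_def field_simps)
        finally show ?thesis .
      qed
      then have "mball f (r / C) \<subseteq> U" using F(4) by (auto simp: mball_def)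
      moreover have "r / C > 0" using F(3) sum by (simp add: C_def)
      ultimately show ?thesis by blast
    qed
    moreover have "U \<subseteq> S" using U by (simp add: tau_K_def openin_seminorm_topology)
    ultimately show "openin mtopology U" by (simp add: openin_mtopology)
  next
    assume U: "openin mtopology U"
    then have US: "U \<subseteq> S" by (simp add: openin_mtopology)
    let ?p = "seminorm_K UNIV (\<lambda>_. 0) :: ('a \<Rightarrow> real) \<Rightarrow> real"
    have "\<exists>F r. finite F \<and> F \<subseteq> ?P \<and> 0 < r \<and> {g \<in> S. \<forall>p\<in>F. p (\<lambda>x. g x - f x) < r} \<subseteq> U"
      if f: "f \<in> U" for f
    proof -
      obtain r where r: "r > 0" "mball f r \<subseteq> U" using f U by (auto simp: openin_mtopology)
      have "g \<in> mball f r" if g: "g \<in> S" "?p (\<lambda>x. g x - f x) < r" for g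
      proof -
        have fS: "f \<in> S" using f US by blast
        have "d f g \<le> ?p (\<lambda>x. g x - f x)"
        proof (rule d_le[OF fS g(1)])
          show "\<bar>f x - g x\<bar> \<le> ?p (\<lambda>x. g x - f x)" for x
            using abs_le_seminorm_K[OF B[OF g(1) fS], of x UNIV "\<lambda>_. 0"]
            by (simp add: abs_minus_commute)
        qed
        then show ?thesis using fS g by simp
      qed
      then show ?thesis
        using r compact zero_in_ca by (intro exI[of _ "{?p}"] exI[of _ r]) auto
    qed
    with US show "openin (tau_K S) U" unfolding tau_K_def openin_seminorm_topology by blast
  qed
  then have "tau_K S = mtopology" by (simp add: topology_eq)
  then show ?thesis using metrizable_space_mtopology by simp
qed

text \<open>The humps are centred at the points of a sequence \<open>x\<close> without convergent subsequence, and their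
  radii \<open>1 / Suc k\<close> shrink. If infinitely many of them met a compact set, points in the intersections
  would have a convergent subsequence, and the corresponding centres would converge with it.\<close>

lemma escaping_humps:
  assumes "\<not> compact (UNIV :: 'a::metric_space set)"
  obtains h :: "nat \<Rightarrow> 'a::metric_space \<Rightarrow> real" and x where
    "\<And>k. h k \<in> UCb" "\<And>k y. 0 \<le> h k y" "\<And>k y. h k y \<le> 1" "\<And>k. h k (x k) = 1"
    "\<And>K. compact K \<Longrightarrow> \<forall>\<^sub>F k in sequentially. \<forall>y\<in>K. h k y = 0"
proof -
  obtain x :: "nat \<Rightarrow> 'a" where x: "\<And>l r. strict_mono r \<Longrightarrow> \<not> (x \<circ> r) \<longlonglongrightarrow> l"
    using assms by (auto simp: compact_eq_seq_compact_metric seq_compact_def)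
  define h where "h k y = max 0 (1 - real (Suc k) * dist y (x k))" for k y
  have hU: "h k \<in> UCb" for k
  proof (rule Lipschitz_in_UCb)
    fix y z
    have "\<bar>real (Suc k) * dist z (x k) - real (Suc k) * dist y (x k)\<bar> \<le> real (Suc k) * dist y z"
      using abs_dist_diff_le[of z "x k" y]
      by (simp add: abs_mult dist_commute mult_left_mono flip: right_diff_distrib)
    then show "\<bar>h k y - h k z\<bar> \<le> real (Suc k) * dist y z"
      unfolding h_def by linarith
    show "\<bar>h k y\<bar> \<le> 1" by (simp add: h_def)
  qed simp
  have "\<forall>\<^sub>F k in sequentially. \<forall>y\<in>K. h k y = 0" if K: "compact K" for K
  proof (rule ccontr)
    assume "\<not> ?thesis"
    then have "\<exists>r :: nat \<Rightarrow> nat. strict_mono r \<and> (\<forall>n. \<not> (\<forall>y\<in>K. h (r n) y = 0))"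
      by (rule not_eventually_sequentiallyD)
    then obtain r :: "nat \<Rightarrow> nat" where r: "strict_mono r" "\<And>n. \<not> (\<forall>y\<in>K. h (r n) y = 0)"
      by blast
    then obtain y where y: "\<And>n. y n \<in> K" "\<And>n. h (r n) (y n) \<noteq> 0" by metis
    have close: "dist (x (r n)) (y n) < 1 / real (Suc (r n))" for n
      using y(2)[of n] by (auto simp: h_def dist_commute field_simps max_def split: if_splits)
    obtain l s where s: "strict_mono s" "(y \<circ> s) \<longlonglongrightarrow> l"
      using K y(1) by (metis compact_eq_seq_compact_metric seq_compact_def)
    have rs: "strict_mono (r \<circ> s)" using r(1) s(1) by (rule strict_mono_o)
    have "(\<lambda>n. 1 / real (Suc ((r \<circ> s) n))) \<longlonglongrightarrow> 0"
      using LIMSEQ_subseq_LIMSEQ[OF LIMSEQ_Suc[OF lim_1_over_n] rs] by (simp add: o_def)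
    then have "(\<lambda>n. dist (x ((r \<circ> s) n)) (y (s n))) \<longlonglongrightarrow> 0"
      by (rule tendsto_sandwich[OF _ _ tendsto_const, rotated 2])
         (use close in \<open>auto intro!: always_eventually less_imp_le\<close>)
    moreover have "(\<lambda>n. dist (y (s n)) l) \<longlonglongrightarrow> 0"
      using tendsto_dist_iff[THEN iffD1, OF s(2)] by (simp add: o_def)
    ultimately have "(\<lambda>n. dist (x ((r \<circ> s) n)) (y (s n)) + dist (y (s n)) l) \<longlonglongrightarrow> 0"
      by (rule tendsto_add_zero)
    then have "(\<lambda>n. dist (x ((r \<circ> s) n)) l) \<longlonglongrightarrow> 0"
      by (rule tendsto_sandwich[OF _ _ tendsto_const, rotated 2])
         (auto intro!: always_eventually dist_triangle)
    then have "(x \<circ> (r \<circ> s)) \<longlonglongrightarrow> l"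
      by (subst tendsto_dist_iff) (simp add: o_def)
    with x[OF rs] show False by blast
  qed
  then show ?thesis using hU by (intro that[of h x]) (auto simp: h_def)
qed

text \<open>In a metrizable topology one could choose \<open>k n\<close> such that \<open>n\<close> times the hump \<open>h (k n)\<close> tends to 0.
  The integrals of these multiples against each measure would then be bounded, but their maxima \<open>n\<close>
  are not.\<close>

lemma compact_if_metrizable_tau_K:
  fixes S :: "('a::metric_space \<Rightarrow> real) set"
  assumes S: "UCb \<subseteq> S" "S \<subseteq> Bb" and metr: "metrizable_space (tau_K S)"
  shows "compact (UNIV :: 'a set)"
proof (rule ccontr)
  assume noncompact: "\<not> ?thesis"
  obtain h :: "nat \<Rightarrow> 'a \<Rightarrow> real" and x where h: "\<And>k. h k \<in> UCb" "\<And>k y. 0 \<le> h k y"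
      "\<And>k y. h k y \<le> 1" "\<And>k. h k (x k) = 1"
    and vanish: "\<And>K. compact K \<Longrightarrow> \<forall>\<^sub>F k in sequentially. \<forall>y\<in>K. h k y = 0"
    using escaping_humps[OF noncompact] by blast
  have scaled: "(\<lambda>y. real n * h k y) \<in> S" for n k
    using h(1)[of k] S(1) uniformly_continuous_on_cmul[of UNIV "h k" "real n"]
      bounded_scaling[of "range (h k)" "real n"]
    by (auto simp: UCb_def image_image)
  then have scaledB: "(\<lambda>y. real n * h k y) \<in> Bb" for n k using S(2) by blast
  have zero_S: "(\<lambda>_. 0) \<in> S" using zero_in_UCb S(1) by blast
  have lim: "limitin (tau_K S) (\<lambda>k y. real n * h k y) (\<lambda>_. 0) sequentially" for n
  proof (rule limitin_tau_KI[OF S(2) scaled zero_S])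
    show unif: "uniform_limit K (\<lambda>k y. real n * h k y) (\<lambda>_. 0) sequentially"
      if "compact K" for K
    proof (rule uniform_limitI)
      fix e :: real assume "e > 0"
      then show "\<forall>\<^sub>F k in sequentially. \<forall>y\<in>K. dist (real n * h k y) 0 < e"
        using vanish[OF that] by (auto elim: eventually_mono)
    qed
    fix \<mu> :: "'a set \<Rightarrow> real" assume mu: "\<mu> \<in> ca"
    show "(\<lambda>k. signed_integral \<mu> (\<lambda>y. real n * h k y)) \<longlonglongrightarrow> signed_integral \<mu> (\<lambda>_. 0)"
    proof (rule tendsto_signed_integral[OF mu, where C = "real n"])
      show "(\<lambda>y. real n * h k y) \<in> borel_measurable borel" for k
        using scaledB by (simp add: Bb_def)
      show "\<bar>real n * h k y\<bar> \<le> real n" for k y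
        using h(2,3)[of k y] by (simp add: abs_mult mult_left_le)
      show "(\<lambda>k. real n * h k y) \<longlonglongrightarrow> 0" for y
        by (rule tendsto_uniform_limitI[OF unif[of "{y}"]]) auto
    qed
  qed
  obtain M d where "Metric_space M d" and M: "tau_K S = Metric_space.mtopology M d"
    using metr by (auto simp: metrizable_space_def)
  then interpret Metric_space M d by simp
  have "\<exists>k. d (\<lambda>y. real n * h k y) (\<lambda>_. 0) < 1 / real (Suc n)" for n
    using lim[of n] unfolding M limit_metric_sequentially
    by (meson of_nat_0_less_iff order_refl zero_less_Suc zero_less_divide_1_iff)
  then obtain k where k: "\<And>n. d (\<lambda>y. real n * h (k n) y) (\<lambda>_. 0) < 1 / real (Suc n)"
    by metis
  define g where "g n y = real n * h (k n) y" for n y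
  have gS: "g n \<in> S" for n using scaled by (simp add: g_def[abs_def])
  have MS: "M = S"
    using arg_cong[OF M, of topspace] by (simp add: tau_K_def)
  have "limitin (tau_K S) g (\<lambda>_. 0) sequentially"
    unfolding M limit_metric_sequentially
  proof (intro conjI allI impI)
    fix e :: real assume "e > 0"
    then obtain N where "1 / real (Suc N) < e" using nat_approx_posE by auto
    then have "d (g n) (\<lambda>_. 0) < e" if "n \<ge> N" for n
      using k[of n] that frac_le[of 1 1 "real (Suc N)" "real (Suc n)"]
      by (simp add: g_def[abs_def])
    then show "\<exists>N. \<forall>n\<ge>N. g n \<in> M \<and> d (g n) (\<lambda>_. 0) < e" using gS MS by blast
  qed (use zero_S MS in simp)
  note D = limitin_tau_KD[OF S(2) gS this]
  have "\<exists>C. \<forall>n y. \<bar>g n y\<bar> \<le> C"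
  proof (rule weakly_bounded_imp_bounded)
    show "g n \<in> Bb" for n using gS S(2) by blast
    show "bounded (range (\<lambda>n. signed_integral \<mu> (g n)))" if "\<mu> \<in> ca" for \<mu>
      using D(3)[OF that] by (rule convergent_imp_bounded)
  qed
  then obtain C where C: "\<forall>n y. \<bar>g n y\<bar> \<le> C" by blast
  obtain n where "real n > C" using reals_Archimedean2 by blast
  moreover have "g n (x (k n)) = real n" using h(4) by (simp add: g_def)
  ultimately show False using C by (metis abs_of_nat not_less)
qed

theorem proposition4p15:
  shows
    "(sequentially_complete (sigma_ca (Bb :: ('a::metric_space \<Rightarrow> real) set)) \<and>
      sequentially_complete (tau_K (Bb :: ('a \<Rightarrow> real) set))) \<and>
     (closedin (tau_K (Bb :: ('a \<Rightarrow> real) set)) Cb \<and>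
      sequentially_complete (tau_K (Cb :: ('a \<Rightarrow> real) set))) \<and>
     ((\<exists>B :: 'b::polish_space set. B \<in> sets borel \<and> (UNIV :: 'a set) homeomorphic B) \<longrightarrow>
      tau_K Cb closure_of (UCb :: ('a \<Rightarrow> real) set) = Cb) \<and>
     (sequentially_complete (tau_K (UCb :: ('a \<Rightarrow> real) set)) \<longleftrightarrow>
      (UCb :: ('a \<Rightarrow> real) set) = Cb) \<and>
     (\<forall>S \<in> {Bb, Cb, UCb :: ('a \<Rightarrow> real) set}.
        metrizable_space (tau_K S) \<longleftrightarrow> compact (UNIV :: 'a set))"
proof -
  have "metrizable_space (tau_K S) \<longleftrightarrow> compact (UNIV :: 'a set)"
    if "S \<in> {Bb, Cb, UCb :: ('a \<Rightarrow> real) set}" for S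
  proof -
    have "UCb \<subseteq> S" "S \<subseteq> Bb"
      using that UCb_subset_Cb[where 'a = 'a] Cb_subset_Bb[where 'a = 'a] by auto
    then show ?thesis
      using compact_if_metrizable_tau_K metrizable_tau_K_if_compact by blast
  qed
  then show ?thesis
    using sequentially_complete_sigma_ca sequentially_complete_tau_K_Bb closedin_tau_K_Cb
      sequentially_complete_tau_K_Cb UCb_dense_in_Cb UCb_complete_iff by blast
qed

end
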